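(* Let $d\ge2$, $1<p<\infty$, $1\le\theta\le\infty$, and let $\boldsymbol r\in\mathbb R^d$ satisfy $0<r_1=\dots=r_\nu<r_{\nu+1}\le\dots\le r_d$ for some $1\le\nu\le d$. Put $\boldsymbol\gamma=\boldsymbol r/r_1$, and let $\boldsymbol\gamma'\in\mathbb R^d$ satisfy $\gamma'_j=\gamma_j=1$ for $j=1,\dots,\nu$ and $1<\gamma'_j<\gamma_j$ for $j=\nu+1,\dots,d$. Then $$\mathscr E_{Q_n^{\boldsymbol\gamma'}}(B^{\boldsymbol r}_{p,\theta})_{B_{p,1}}\asymp E_{Q_n^{\boldsymbol\gamma'}}(B^{\boldsymbol r}_{p,\theta})_{B_{p,1}}\asymp 2^{-nr_1}\,n^{(\nu-1)\left(1-\frac1\theta\right)},\qquad n\in\mathbb N.$$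
   Context: Functions are complex-valued, $2\pi$-periodic in each of $d$ variables; $\|\cdot\|_p$ is the $L_p(\mathbb T^d)$ norm with respect to $(2\pi)^{-d}d\boldsymbol x$ on $\mathbb T^d=[0,2\pi)^d$ (essential supremum for $p=\infty$). $L_p^0=\{f\in L_p(\mathbb T^d):\int_0^{2\pi}f(\boldsymbol x)\,dx_j=0\text{ a.e.},\ j=1,\dots,d\}$. $(\boldsymbol x,\boldsymbol y)=\sum_j x_jy_j$. $1/\theta:=0$ for $\theta=\infty$. Blocks. For $\boldsymbol s\in\mathbb N^d$ ($\mathbb N=\{1,2,\dots\}$), $\rho(\boldsymbol s)=\{\boldsymbol k\in\mathbb Z^d:2^{s_j-1}\le|k_j|<2^{s_j},\ j=1,\dots,d\}$ and $\delta_{\boldsymbol s}(f)=\sum_{\boldsymbol k\in\rho(\boldsymbol s)}\widehat f(\boldsymbol k)e^{i(\boldsymbol k,\boldsymbol x)}$, with $\widehat f(\boldsymbol k)=(2\pi)^{-d}\int_{\mathbb T^d}f(\boldsymbol t)e^{-i(\boldsymbol k,\boldsymbol t)}d\boldsymbol t$. De la Vallée-Poussin kernel: $V_l(t)=1+2\sum_{k=1}^l\cos kt+2\sum_{k=l+1}^{2l-1}\left(1-\frac{k-l}{l}\right)\cos kt$ (last sum is zero for $l=1$). Put $a_1=V_2-1$, $a_s=V_{2^s}-V_{2^{s-1}}$ for $s\ge2$, $A_{\boldsymbol s}(\boldsymbol x)=\prod_{j=1}^d a_{s_j}(x_j)$, and $A_{\boldsymbol s}(f)=f*A_{\boldsymbol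 s}$ (convolution with respect to $(2\pi)^{-d}d\boldsymbol x$). Class $B^{\boldsymbol r}_{p,\theta}$ ($1<p<\infty$): the set of $f\in L_p^0$ with $\|f\|_{B^{\boldsymbol r}_{p,\theta}}\le1$, where $\|f\|_{B^{\boldsymbol r}_{p,\theta}}=\left(\sum_{\boldsymbol s\in\mathbb N^d}2^{(\boldsymbol s,\boldsymbol r)\theta}\|\delta_{\boldsymbol s}(f)\|_p^\theta\right)^{1/\theta}$ for $\theta<\infty$ and $\sup_{\boldsymbol s}2^{(\boldsymbol s,\boldsymbol r)}\|\delta_{\boldsymbol s}(f)\|_p$ for $\theta=\infty$. Space $B_{q,1}$ ($1\le q\le\infty$): all $f\in L_q^0$ with $\|f\|_{B_{q,1}}:=\sum_{\boldsymbol s\in\mathbb N^d}\|A_{\boldsymbol s}(f)\|_q<\infty$. Approximation quantities. For a vector $\boldsymbol\beta\in\mathbb R^d$ with positive coordinates, $Q_n^{\boldsymbol\beta}=\bigcup_{\boldsymbol s\in\mathbb N^d,\ (\boldsymbol s,\boldsymbol\beta)<n}\rho(\boldsymbol s)$; $T(Q_n^{\boldsymbol\beta})$ is the set of trigonometric polynomials $\sum_{\boldsymbol k\in Q_n^{\boldsymbol\beta}}c_{\boldsymbol k}e^{i(\boldsymbol k,\boldsymbol x)}$, $c_{\boldsymbol k}\in\mathbb C$; $S_{Q_n^{\boldsymbol\beta}}(f)=\sum_{\boldsymbol k\in Q_n^{\boldsymbol\beta}}\widehat f(\boldsymbol k)e^{i(\boldsymbol k,\boldsymbol x)}$. For a class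 $F$ in a normed space $\mathscr X$: $E_{Q_n^{\boldsymbol\beta}}(F)_{\mathscr X}=\sup_{f\in F}\inf_{t\in T(Q_n^{\boldsymbol\beta})}\|f-t\|_{\mathscr X}$ and $\mathscr E_{Q_n^{\boldsymbol\beta}}(F)_{\mathscr X}=\sup_{f\in F}\|f-S_{Q_n^{\boldsymbol\beta}}(f)\|_{\mathscr X}$. $a(n)\asymp b(n)$ means that there are constants $C_1,C_2>0$ independent of $n$ with $C_1a(n)\le b(n)\le C_2a(n)$ (the constants may depend on $d$ and all other fixed parameters). *)

theory Defs
  imports "HOL-Analysis.Analysis"
begin

text \<open>
  The dimension \<open>d\<close> is \<open>CARD('d)\<close>. Norms take values in \<open>ennreal\<close>, so that they are meaningful
  for every function and suprema over function classes always exist.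
\<close>

text \<open>Only used for exponents \<open>a > 0\<close>.\<close>

definition epowr :: "ennreal \<Rightarrow> real \<Rightarrow> ennreal" where
  "epowr x a = (if x = \<infinity> then \<infinity> else ennreal (enn2real x powr a))"

definition torus :: "(real ^ 'd) measure" where
  "torus = density lborel
     (\<lambda>x. ennreal (indicator {x. \<forall>j. 0 \<le> x $ j \<and> x $ j < 2 * pi} x / (2 * pi) ^ CARD('d)))"

definition periodic :: "(real ^ 'd \<Rightarrow> complex) \<Rightarrow> bool" where
  "periodic f \<longleftrightarrow> (\<forall>x j. f (x + axis j (2 * pi)) = f x)"

text \<open>Finite exponents \<open>1 \<le> p < \<infinity>\<close> only.\<close>

definition Lp_norm :: "real \<Rightarrow> (real ^ 'd \<Rightarrow> complex) \<Rightarrow> ennreal" where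
  "Lp_norm p f = epowr (\<integral>\<^sup>+ x. ennreal (cmod (f x) powr p) \<partial>torus) (1 / p)"

text \<open>
  Elements of \<open>L\<^sub>p\<close> are represented by everywhere defined Borel functions on \<open>\<real>\<^sup>d\<close>; every class
  modulo null sets has such a periodic representative. For almost every \<open>x\<close> the one-dimensional
  section below is integrable, because \<open>L\<^sub>p \<subseteq> L\<^sub>1\<close> for \<open>p \<ge> 1\<close>.
\<close>

definition Lp :: "real \<Rightarrow> (real ^ 'd \<Rightarrow> complex) set" where
  "Lp p = {f \<in> borel_measurable borel. periodic f \<and> Lp_norm p f < \<infinity>}"

definition Lp0 :: "real \<Rightarrow> (real ^ 'd \<Rightarrow> complex) set" where
  "Lp0 p = {f \<in> Lp p. \<forall>j. AE x in torus.
     (LINT t:{0..2 * pi}|lborel. f (\<chi> i. if i = j then t else x $ i)) = 0}"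

definition char_exp :: "int ^ 'd \<Rightarrow> real ^ 'd \<Rightarrow> complex" where
  "char_exp k x = exp (\<i> * of_real (\<Sum>j\<in>UNIV. of_int (k $ j) * x $ j))"

definition fourier_coeff :: "(real ^ 'd \<Rightarrow> complex) \<Rightarrow> int ^ 'd \<Rightarrow> complex" where
  "fourier_coeff f k = (LINT t|torus. f t * char_exp (- k) t)"

definition convolution ::
    "(real ^ 'd \<Rightarrow> complex) \<Rightarrow> (real ^ 'd \<Rightarrow> complex) \<Rightarrow> real ^ 'd \<Rightarrow> complex" where
  "convolution f g x = (LINT y|torus. f y * g (x - y))"

definition block_indices :: "(nat ^ 'd) set" where
  "block_indices = {s. \<forall>j. 1 \<le> s $ j}"

definition weight :: "nat ^ 'd \<Rightarrow> real ^ 'd \<Rightarrow> real" where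
  "weight s b = (\<Sum>j\<in>UNIV. real (s $ j) * b $ j)"

text \<open>Only meaningful for \<open>s \<in> block_indices\<close>, because of the truncated subtraction.\<close>

definition rho :: "nat ^ 'd \<Rightarrow> (int ^ 'd) set" where
  "rho s = {k. \<forall>j. 2 ^ (s $ j - 1) \<le> \<bar>k $ j\<bar> \<and> \<bar>k $ j\<bar> < 2 ^ (s $ j)}"

text \<open>Used for finite \<open>Q\<close> only.\<close>

definition fourier_sum ::
    "(int ^ 'd) set \<Rightarrow> (real ^ 'd \<Rightarrow> complex) \<Rightarrow> real ^ 'd \<Rightarrow> complex" where
  "fourier_sum Q f x = (\<Sum>k\<in>Q. fourier_coeff f k * char_exp k x)"

definition delta :: "nat ^ 'd \<Rightarrow> (real ^ 'd \<Rightarrow> complex) \<Rightarrow> real ^ 'd \<Rightarrow> complex" where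
  "delta s f = fourier_sum (rho s) f"

definition VP_kernel :: "nat \<Rightarrow> real \<Rightarrow> real" where
  "VP_kernel l t = 1 + 2 * (\<Sum>k = 1..l. cos (real k * t))
     + 2 * (\<Sum>k = l + 1..2 * l - 1. (1 - (real k - real l) / real l) * cos (real k * t))"

definition a_kernel :: "nat \<Rightarrow> real \<Rightarrow> real" where
  "a_kernel s t = (if s = 1 then VP_kernel 2 t - 1
     else VP_kernel (2 ^ s) t - VP_kernel (2 ^ (s - 1)) t)"

definition A_kernel :: "nat ^ 'd \<Rightarrow> real ^ 'd \<Rightarrow> complex" where
  "A_kernel s x = of_real (\<Prod>j\<in>UNIV. a_kernel (s $ j) (x $ j))"

definition A_block :: "nat ^ 'd \<Rightarrow> (real ^ 'd \<Rightarrow> complex) \<Rightarrow> real ^ 'd \<Rightarrow> complex" where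
  "A_block s f = convolution f (A_kernel s)"

definition B_norm ::
    "real ^ 'd \<Rightarrow> real \<Rightarrow> ennreal \<Rightarrow> (real ^ 'd \<Rightarrow> complex) \<Rightarrow> ennreal" where
  "B_norm r p \<theta> f =
     (if \<theta> = \<infinity>
      then (SUP s\<in>block_indices. ennreal (2 powr weight s r) * Lp_norm p (delta s f))
      else epowr (\<Sum>\<^sub>\<infinity>s\<in>block_indices.
             ennreal (2 powr (weight s r * enn2real \<theta>)) * epowr (Lp_norm p (delta s f)) (enn2real \<theta>))
             (1 / enn2real \<theta>))"

definition B_class :: "real ^ 'd \<Rightarrow> real \<Rightarrow> ennreal \<Rightarrow> (real ^ 'd \<Rightarrow> complex) set" where
  "B_class r p \<theta> = {f \<in> Lp0 p. B_norm r p \<theta> f \<le> 1}"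

text \<open>
  The norm is set to \<open>\<infinity>\<close> outside \<open>Lp0 q\<close>, so the space \<open>B\<^sub>q\<^sub>,\<^sub>1\<close> consists exactly of the functions
  of finite norm.
\<close>

definition Bq1_norm :: "real \<Rightarrow> (real ^ 'd \<Rightarrow> complex) \<Rightarrow> ennreal" where
  "Bq1_norm q f =
     (if f \<in> Lp0 q then (\<Sum>\<^sub>\<infinity>s\<in>block_indices. Lp_norm q (A_block s f)) else \<infinity>)"

definition hyp_cross :: "real ^ 'd \<Rightarrow> nat \<Rightarrow> (int ^ 'd) set" where
  "hyp_cross b n = (\<Union>s\<in>{s \<in> block_indices. weight s b < real n}. rho s)"

definition trig_polys :: "(int ^ 'd) set \<Rightarrow> (real ^ 'd \<Rightarrow> complex) set" where
  "trig_polys Q = {t. \<exists>c. t = (\<lambda>x. \<Sum>k\<in>Q. c k * char_exp k x)}"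

definition best_approx ::
    "(int ^ 'd) set \<Rightarrow> (real ^ 'd \<Rightarrow> complex) set \<Rightarrow> ((real ^ 'd \<Rightarrow> complex) \<Rightarrow> ennreal) \<Rightarrow> ennreal"
  where
  "best_approx Q F nrm = (SUP f\<in>F. INF t\<in>trig_polys Q. nrm (\<lambda>x. f x - t x))"

definition fourier_approx ::
    "(int ^ 'd) set \<Rightarrow> (real ^ 'd \<Rightarrow> complex) set \<Rightarrow> ((real ^ 'd \<Rightarrow> complex) \<Rightarrow> ennreal) \<Rightarrow> ennreal"
  where
  "fourier_approx Q F nrm = (SUP f\<in>F. nrm (\<lambda>x. f x - fourier_sum Q f x))"

definition same_order :: "(nat \<Rightarrow> ennreal) \<Rightarrow> (nat \<Rightarrow> ennreal) \<Rightarrow> bool" (infix \<open>\<asymp>\<close> 50) where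
  "a \<asymp> b \<longleftrightarrow> (\<exists>C1 C2 :: real. C1 > 0 \<and> C2 > 0 \<and>
     (\<forall>n\<ge>1. ennreal C1 * a n \<le> b n \<and> b n \<le> ennreal C2 * a n))"

end

theory Submission
  imports Defs
begin

text \<open>
  The operator \<open>A_block s\<close> only sees the dyadic blocks \<open>rho (s + e)\<close> with \<open>e \<in> {0, 1}\<^sup>d\<close>, and it is a
  combination of Fejer means in each variable, hence bounded in \<open>L\<^sub>p\<close> uniformly in \<open>s\<close>. So the
  \<open>B\<^sub>p\<^sub>,\<^sub>1\<close> norm of the remainder of the Fourier sum is at most a constant times the sum of
  \<open>\<parallel>\<delta>\<^sub>s(f)\<parallel>\<^sub>p\<close> over the \<open>s\<close> with \<open>(s, \<gamma>') \<ge> n\<close>, and Hoelder's inequality reduces the upper bound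
  to the sum of \<open>2 powr - (\<tau> * (s, r))\<close> over these \<open>s\<close>, where \<open>\<tau>\<close> is the exponent conjugate to \<open>\<theta>\<close>
  (for \<open>\<theta> = 1\<close>, to their supremum).

  For the lower bound, \<open>f\<close> is a lacunary polynomial with equal coefficients at about \<open>n ^ (\<nu> - 1)\<close>
  frequencies \<open>(2 ^ s\<^sub>j)\<^sub>j\<close>, one for each of that many \<open>s\<close> with \<open>(s, \<gamma>') \<ge> n\<close> and \<open>(s, r) = n * r\<^sub>1 + O(1)\<close>.
\<close>

section \<open>Norms and translations on the torus\<close>

text \<open>Class and space carry the same exponent \<open>p\<close>, and the cross is a union of
  whole blocks. Hence the remainder of a Fourier sum keeps either all of \<open>delta s f\<close> or
  nothing of it, and the sharp blocks are only measured, never bounded as operators. The bounded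
  operators \<open>A_block s\<close> are applied to one block at a time, that is, to polynomials;
  there, convexity of \<open>x powr p\<close> and finitely many translates do the work of a
  convolution inequality.

  The power of \<open>n\<close> counts the lattice points near the face
  \<open>weight s \<gamma>' = n\<close> in the \<nu> coordinates where \<open>r\<close> is minimal.
  In every other coordinate the gap between \<open>r\<close> and \<open>r $ ix 1\<close> times
  \<gamma>' is positive, so that coordinate contributes only a convergent geometric series.

  With \<open>N\<close> frequencies, the class allows coefficients of relative size
  \<open>N powr - (1 / \<theta>)\<close>, while the target norm adds up \<open>N\<close> of them;
  the exponent \<open>1 - 1 / \<theta>\<close> is this balance.\<close>

lemma epowr_mono: "x \<le> y \<Longrightarrow> 0 \<le> a \<Longrightarrow> epowr x a \<le> epowr y a"
  by (auto simp: epowr_def top_unique intro!: ennreal_leI powr_mono2 enn2real_mono simp: less_top)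

lemma epowr_ennreal: "0 \<le> x \<Longrightarrow> epowr (ennreal x) a = ennreal (x powr a)"
  by (simp add: epowr_def)

lemma epowr_cmult:
  assumes "0 \<le> c" "0 < a"
  shows "epowr (ennreal c * x) a = ennreal (c powr a) * epowr x a"
proof (cases "x = \<infinity>")
  case True
  then show ?thesis
    using assms by (cases "c = 0") (auto simp: epowr_def ennreal_mult_top ennreal_zero_less_top)
next
  case False
  then obtain y where y: "0 \<le> y" "x = ennreal y"
    by (cases x) auto
  show ?thesis
    using assms y by (simp add: epowr_ennreal powr_mult flip: ennreal_mult)
qed

lemma epowr_epowr: "epowr (epowr x a) b = epowr x (a * b)"
  by (cases x) (auto simp: epowr_def powr_powr)

lemma epowr_one [simp]: "epowr x 1 = x"
  by (cases x) (auto simp: epowr_def)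

lemma epowr_eq_top_iff [simp]: "epowr x a = \<infinity> \<longleftrightarrow> x = \<infinity>"
  by (simp add: epowr_def)

text \<open>In the open half-line this is \<open>powr_convex\<close>. If an endpoint is 0, it
  reduces to \<open>u powr p \<le> u\<close> on the unit interval.\<close>

lemma convex_on_powr_nonneg:
  fixes p :: real
  assumes "1 \<le> p"
  shows "convex_on {0..} (\<lambda>x. x powr p)"
proof (rule convex_onI)
  fix t x y :: real
  assume t: "0 < t" "t < 1" and xy: "x \<in> {0..}" "y \<in> {0..}"
  have le: "u powr p \<le> u" if "0 \<le> u" "u \<le> 1" for u :: real
    using powr_mono'[of 1 p u] assms that by (cases "u = 0") auto
  have z: "(u * v) powr p \<le> u * v powr p" if "0 \<le> u" "u \<le> 1" "0 \<le> v" for u v :: real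
    using le[OF that(1,2)] that by (simp add: powr_mult mult_right_mono)
  consider "x = 0" | "y = 0" | "0 < x" "0 < y"
    using xy by fastforce
  then show "((1 - t) *\<^sub>R x + t *\<^sub>R y) powr p \<le> (1 - t) * x powr p + t * y powr p"
  proof cases
    case 3
    then show ?thesis
      using convex_onD[OF powr_convex[OF assms], of t x y] t by simp
  qed (use z t xy in auto)
qed simp

text \<open>Jensen's inequality for the weights \<open>cmod (c i) / K\<close>, where
  \<open>K\<close> is their total; multiplying out \<open>K\<close> gives a form that also covers
  \<open>K = 0\<close>.\<close>

lemma weighted_power_mean:
  fixes c a :: "'i \<Rightarrow> complex" and p :: real
  assumes "finite I" "1 \<le> p"
  shows "cmod (\<Sum>i\<in>I. c i * a i) powr p
    \<le> (\<Sum>i\<in>I. cmod (c i)) powr (p - 1) * (\<Sum>i\<in>I. cmod (c i) * cmod (a i) powr p)"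
proof -
  define K where "K = (\<Sum>i\<in>I. cmod (c i))"
  have K0: "K \<ge> 0" unfolding K_def by (simp add: sum_nonneg)
  show ?thesis
  proof (cases "K = 0")
    case True
    then have "\<forall>i\<in>I. c i = 0"
      using assms unfolding K_def by (simp add: sum_nonneg_eq_0_iff)
    then show ?thesis using assms by simp
  next
    case False
    then have K: "K > 0" using K0 by simp
    have ne: "I \<noteq> {}" using False K_def by auto
    have cv: "(\<Sum>i\<in>I. (cmod (c i) / K) *\<^sub>R cmod (a i)) powr p
        \<le> (\<Sum>i\<in>I. (cmod (c i) / K) * (cmod (a i) powr p))"
      by (rule convex_on_sum[OF assms(1) ne convex_on_powr_nonneg[OF assms(2)]])
        (use K in \<open>auto simp: K_def simp flip: sum_divide_distrib\<close>)
    have "cmod (\<Sum>i\<in>I. c i * a i) \<le> (\<Sum>i\<in>I. cmod (c i) * cmod (a i))"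
      by (rule sum_norm_le) (simp add: norm_mult)
    also have "\<dots> = K * (\<Sum>i\<in>I. (cmod (c i) / K) *\<^sub>R cmod (a i))"
      using K by (simp add: sum_distrib_left)
    finally have "cmod (\<Sum>i\<in>I. c i * a i) powr p
        \<le> (K * (\<Sum>i\<in>I. (cmod (c i) / K) *\<^sub>R cmod (a i))) powr p"
      using assms by (intro powr_mono2) auto
    also have "\<dots> = K powr p * (\<Sum>i\<in>I. (cmod (c i) / K) *\<^sub>R cmod (a i)) powr p"
      using K by (subst powr_mult) (auto intro!: sum_nonneg)
    also have "\<dots> \<le> K powr p * (\<Sum>i\<in>I. (cmod (c i) / K) * (cmod (a i) powr p))"
      by (intro mult_left_mono cv) simp
    also have "\<dots> = K powr (p - 1) * (\<Sum>i\<in>I. cmod (c i) * cmod (a i) powr p)"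
      using K by (simp add: powr_diff sum_divide_distrib[symmetric] field_simps)
    finally show ?thesis unfolding K_def .
  qed
qed

lemma sets_torus [simp, measurable_cong]: "sets torus = sets borel"
  by (simp add: torus_def)

lemma space_torus [simp]: "space torus = UNIV"
  by (simp add: torus_def)

lemma Lp_norm_power:
  assumes "0 < p"
  shows "epowr (Lp_norm p f) p = (\<integral>\<^sup>+ x. ennreal (cmod (f x) powr p) \<partial>torus)"
  using assms by (simp add: Lp_norm_def epowr_epowr)

text \<open>Replaces Minkowski's inequality: with one common bound \<open>B\<close> for all members,
  integrating the pointwise Jensen inequality is enough. \<open>B\<close> may be infinite.\<close>

lemma Lp_norm_sum_le:
  fixes f :: "'i \<Rightarrow> real ^ 'd \<Rightarrow> complex"
  assumes p: "1 \<le> p" and I: "finite I"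
    and meas [measurable]: "\<And>i. i \<in> I \<Longrightarrow> f i \<in> borel_measurable borel"
    and le: "\<And>i. i \<in> I \<Longrightarrow> Lp_norm p (f i) \<le> B"
  shows "Lp_norm p (\<lambda>x. \<Sum>i\<in>I. c i * f i x) \<le> ennreal (\<Sum>i\<in>I. cmod (c i)) * B"
proof -
  define K where "K = (\<Sum>i\<in>I. cmod (c i))"
  have K0: "K \<ge> 0" unfolding K_def by (simp add: sum_nonneg)
  have "(\<integral>\<^sup>+ x. ennreal (cmod (\<Sum>i\<in>I. c i * f i x) powr p) \<partial>torus)
      \<le> (\<integral>\<^sup>+ x. ennreal (K powr (p - 1)) *
            (\<Sum>i\<in>I. ennreal (cmod (c i)) * ennreal (cmod (f i x) powr p)) \<partial>torus)"
  proof (rule nn_integral_mono)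
    fix x
    have "ennreal (cmod (\<Sum>i\<in>I. c i * f i x) powr p)
        \<le> ennreal (K powr (p - 1) * (\<Sum>i\<in>I. cmod (c i) * cmod (f i x) powr p))"
      unfolding K_def by (intro ennreal_leI weighted_power_mean I p)
    also have "\<dots> = ennreal (K powr (p - 1)) *
        (\<Sum>i\<in>I. ennreal (cmod (c i)) * ennreal (cmod (f i x) powr p))"
      by (simp add: ennreal_mult' ennreal_mult'' sum_nonneg flip: sum_ennreal)
    finally show "ennreal (cmod (\<Sum>i\<in>I. c i * f i x) powr p) \<le> \<dots>" .
  qed
  also have "\<dots> = ennreal (K powr (p - 1)) *
      (\<Sum>i\<in>I. ennreal (cmod (c i)) * (\<integral>\<^sup>+ x. ennreal (cmod (f i x) powr p) \<partial>torus))"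
    by (subst nn_integral_cmult, measurable, subst nn_integral_sum, measurable)
      (auto intro!: sum.cong arg_cong2[where f="(*)"] nn_integral_cmult)
  also have "\<dots> \<le> ennreal (K powr (p - 1)) * (\<Sum>i\<in>I. ennreal (cmod (c i)) * epowr B p)"
    using p le by (intro mult_left_mono sum_mono)
      (auto simp: epowr_mono simp flip: Lp_norm_power)
  also have "\<dots> = ennreal (K powr (p - 1)) * (ennreal K * epowr B p)"
    by (simp add: K_def sum_distrib_right flip: sum_ennreal)
  also have "\<dots> = ennreal (K powr p) * epowr B p"
  proof (cases "K = 0")
    case False
    then have "K powr (p - 1) * K = K powr p" using K0 by (simp add: powr_diff)
    then show ?thesis using K0 by (simp flip: mult.assoc ennreal_mult)
  qed (use p in simp)
  also have "\<dots> = epowr (ennreal K * B) p"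
    using p K0 by (simp add: epowr_cmult)
  finally have "epowr (\<integral>\<^sup>+ x. ennreal (cmod (\<Sum>i\<in>I. c i * f i x) powr p) \<partial>torus) (1/p)
      \<le> epowr (epowr (ennreal K * B) p) (1/p)"
    using p by (intro epowr_mono) auto
  then show ?thesis
    using p by (simp add: Lp_norm_def epowr_epowr K_def)
qed

definition cube :: "(real ^ 'd) set" where
  "cube = {x. \<forall>j. 0 \<le> x $ j \<and> x $ j < 2 * pi}"

lemma cube_borel [measurable]: "cube \<in> sets borel"
  unfolding cube_def by measurable

lemma nn_integral_torus:
  fixes g :: "real ^ 'd \<Rightarrow> ennreal"
  assumes [measurable]: "g \<in> borel_measurable borel"
  shows "(\<integral>\<^sup>+ x. g x \<partial>torus)
    = ennreal (1 / (2 * pi) ^ CARD('d)) * (\<integral>\<^sup>+ x. indicator cube x * g x \<partial>lborel)"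
proof -
  have m: "(\<lambda>x::real^'d. ennreal (indicator cube x / (2 * pi) ^ CARD('d))) \<in> borel_measurable lborel"
    by measurable
  have "(\<integral>\<^sup>+ x. g x \<partial>torus)
      = (\<integral>\<^sup>+ x. ennreal (indicator cube x / (2 * pi) ^ CARD('d)) * g x \<partial>lborel)"
    unfolding torus_def cube_def[symmetric] by (rule nn_integral_density[OF m]) measurable
  also have "\<dots> = (\<integral>\<^sup>+ x. ennreal (1 / (2 * pi) ^ CARD('d)) * (indicator cube x * g x) \<partial>lborel)"
    by (intro nn_integral_cong) (auto simp: indicator_def)
  also have "\<dots> = ennreal (1 / (2 * pi) ^ CARD('d)) * (\<integral>\<^sup>+ x. indicator cube x * g x \<partial>lborel)"
    by (rule nn_integral_cmult) measurable
  finally show ?thesis .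
qed

lemma nn_integral_lborel_translate:
  fixes g :: "'a :: euclidean_space \<Rightarrow> ennreal"
  assumes [measurable]: "g \<in> borel_measurable borel"
  shows "(\<integral>\<^sup>+ x. g (c + x) \<partial>lborel) = (\<integral>\<^sup>+ x. g x \<partial>lborel)"
  by (subst (2) lborel_distr_plus[of c, symmetric]) (simp add: nn_integral_distr)

text \<open>The translated cube is cut at \<open>x $ j = 2 * pi\<close>. Moving the overhang
  \<open>B\<close> back by one period fills exactly the slab \<open>x $ j < h\<close> that the part
  \<open>A\<close> leaves empty.\<close>

lemma nn_integral_torus_shift:
  fixes g :: "real ^ 'd \<Rightarrow> ennreal"
  assumes g [measurable]: "g \<in> borel_measurable borel"
    and per: "\<And>x. g (x + axis j (2 * pi)) = g x"
    and h: "0 \<le> h" "h < 2 * pi"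
  shows "(\<integral>\<^sup>+ x. g (x + axis j h) \<partial>torus) = (\<integral>\<^sup>+ x. g x \<partial>torus)"
proof -
  let ?e = "axis j h :: real ^ 'd" and ?P = "axis j (2 * pi) :: real ^ 'd"
  define A where "A = {x. x - ?e \<in> cube \<and> x $ j < 2 * pi}"
  define B where "B = {x. x - ?e \<in> cube \<and> 2 * pi \<le> x $ j}"
  have [measurable]: "A \<in> sets borel" "B \<in> sets borel"
    unfolding A_def B_def cube_def by measurable
  have "(\<integral>\<^sup>+ x. indicator cube x * g (x + ?e) \<partial>lborel)
      = (\<integral>\<^sup>+ x. indicator cube ((?e + x) - ?e) * g (?e + x) \<partial>lborel)"
    by (simp add: add.commute)
  also have "\<dots> = (\<integral>\<^sup>+ x. indicator cube (x - ?e) * g x \<partial>lborel)"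
    by (rule nn_integral_lborel_translate) measurable
  also have "\<dots> = (\<integral>\<^sup>+ x. indicator A x * g x + indicator B x * g x \<partial>lborel)"
    by (intro nn_integral_cong) (auto simp: A_def B_def indicator_def)
  also have "\<dots> = (\<integral>\<^sup>+ x. indicator A x * g x \<partial>lborel) + (\<integral>\<^sup>+ x. indicator B x * g x \<partial>lborel)"
    by (rule nn_integral_add) measurable
  also have "(\<integral>\<^sup>+ x. indicator B x * g x \<partial>lborel)
      = (\<integral>\<^sup>+ x. indicator B (?P + x) * g (?P + x) \<partial>lborel)"
    by (rule nn_integral_lborel_translate[symmetric]) measurable
  also have "\<dots> = (\<integral>\<^sup>+ x. indicator B (?P + x) * g x \<partial>lborel)"
    using per by (simp add: add.commute)
  also have "(\<integral>\<^sup>+ x. indicator A x * g x \<partial>lborel) + \<dots>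
      = (\<integral>\<^sup>+ x. indicator A x * g x + indicator B (?P + x) * g x \<partial>lborel)"
    by (rule nn_integral_add[symmetric]) measurable
  also have "\<dots> = (\<integral>\<^sup>+ x. indicator cube x * g x \<partial>lborel)"
  proof (intro nn_integral_cong)
    fix x :: "real ^ 'd"
    have off: "y \<in> cube \<longleftrightarrow> (\<forall>i. i \<noteq> j \<longrightarrow> 0 \<le> y $ i \<and> y $ i < 2 * pi) \<and> 0 \<le> y $ j \<and> y $ j < 2 * pi"
      for y :: "real ^ 'd"
      unfolding cube_def by auto
    have 1: "x \<in> A \<longleftrightarrow> x \<in> cube \<and> h \<le> x $ j"
      using h unfolding A_def off by (auto simp: axis_def)
    have 2: "?P + x \<in> B \<longleftrightarrow> x \<in> cube \<and> x $ j < h"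
      using h unfolding B_def off by (auto simp: axis_def)
    show "indicator A x * g x + indicator B (?P + x) * g x = indicator cube x * g x"
      using 1 2 by (auto simp: indicator_def not_le)
  qed
  finally have "(\<integral>\<^sup>+ x. indicator cube x * g (x + ?e) \<partial>lborel) = (\<integral>\<^sup>+ x. indicator cube x * g x \<partial>lborel)" .
  then show ?thesis
    by (simp add: nn_integral_torus)
qed

text \<open>The half-open cube lies between the open and the closed box, which have equal
  volume.\<close>

lemma emeasure_lborel_cube: "emeasure lborel (cube :: (real ^ 'd) set) = ennreal ((2 * pi) ^ CARD('d))"
proof -
  let ?u = "(\<chi> i. 2 * pi) :: real ^ 'd"
  have bi: "0 \<bullet> b \<le> ?u \<bullet> b" if "b \<in> Basis" for b :: "real ^ 'd"
    using that by (auto simp: Basis_vec_def inner_axis)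
  have pr: "(\<Prod>b\<in>Basis. (?u - 0) \<bullet> b) = (2 * pi) ^ CARD('d)"
  proof -
    have "(\<Prod>b\<in>Basis. (?u - 0) \<bullet> b) = (\<Prod>b\<in>(Basis :: (real ^ 'd) set). 2 * pi)"
      by (rule prod.cong) (auto simp: Basis_vec_def inner_axis)
    also have "\<dots> = (2 * pi) ^ DIM(real ^ 'd)"
      by (rule prod_constant)
    finally show ?thesis by simp
  qed
  have le: "emeasure lborel (box 0 ?u) \<le> emeasure lborel (cube :: (real ^ 'd) set)"
  proof (rule emeasure_mono)
    show "box 0 ?u \<subseteq> cube"
      unfolding cube_def mem_box_cart subset_iff by (simp add: less_imp_le)
    show "cube \<in> sets lborel"
      by measurable
  qed
  have ge: "emeasure lborel (cube :: (real ^ 'd) set) \<le> emeasure lborel (cbox 0 ?u)"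
  proof (rule emeasure_mono)
    show "cube \<subseteq> cbox 0 ?u"
      unfolding cube_def mem_box_cart subset_iff by (simp add: less_imp_le)
  qed simp
  show ?thesis
    using le ge bi pr by (intro antisym) (simp_all add: emeasure_lborel_box emeasure_lborel_cbox)
qed

lemma emeasure_torus: "emeasure torus (UNIV :: (real ^ 'd) set) = 1"
proof -
  have "(\<integral>\<^sup>+ x. 1 \<partial>(torus :: (real ^ 'd) measure))
      = ennreal (1 / (2 * pi) ^ CARD('d)) * ennreal ((2 * pi) ^ CARD('d))"
    by (subst nn_integral_torus) (auto simp: emeasure_lborel_cube)
  also have "\<dots> = 1"
    by (simp add: flip: ennreal_mult)
  finally show ?thesis by simp
qed

lemma finite_measure_torus: "finite_measure (torus :: (real ^ 'd) measure)"
  by standard (simp add: emeasure_torus)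

section \<open>Fejer multipliers on trigonometric polynomials\<close>

lemma char_exp_cis: "char_exp k x = cis (\<Sum>j\<in>UNIV. of_int (k $ j) * x $ j)"
  by (simp add: char_exp_def cis_conv_exp)

lemma norm_char_exp [simp]: "cmod (char_exp k x) = 1"
  by (simp add: char_exp_cis)

lemma char_exp_add: "char_exp k (x + y) = char_exp k x * char_exp k y"
  by (simp add: char_exp_cis cis_mult distrib_left sum.distrib)

lemma char_exp_add_index: "char_exp (k + l) x = char_exp k x * char_exp l x"
  by (simp add: char_exp_cis cis_mult distrib_right sum.distrib)

lemma char_exp_uminus: "char_exp (- k) x = char_exp k (- x)"
  by (simp add: char_exp_cis)

lemma char_exp_axis: "char_exp k (axis j t) = cis (of_int (k $ j) * t)"
  by (simp add: char_exp_cis axis_def if_distrib cong: if_cong)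

lemma char_exp_zero [simp]: "char_exp 0 x = 1"
  by (simp add: char_exp_cis)

lemma char_exp_periodic: "char_exp k (x + axis j (2 * pi)) = char_exp k x"
  using cis_multiple_2pi[of "of_int (k $ j)"]
  by (simp add: char_exp_add char_exp_axis mult.commute mult.left_commute)

lemma char_exp_borel [measurable]: "char_exp k \<in> borel_measurable borel"
  unfolding char_exp_def by measurable

definition trig_poly :: "(int ^ 'd) set \<Rightarrow> (int ^ 'd \<Rightarrow> complex) \<Rightarrow> real ^ 'd \<Rightarrow> complex" where
  "trig_poly R c x = (\<Sum>k\<in>R. c k * char_exp k x)"

lemma trig_poly_borel [measurable]: "trig_poly R c \<in> borel_measurable borel"
  unfolding trig_poly_def by measurable

lemma trig_poly_periodic: "trig_poly R c (x + axis j (2 * pi)) = trig_poly R c x"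
  by (simp add: trig_poly_def char_exp_periodic)

lemma Lp_norm_trig_poly_shift:
  assumes "0 \<le> h" "h < 2 * pi"
  shows "Lp_norm p (\<lambda>x. trig_poly R c (x + axis j h)) = Lp_norm p (trig_poly R c)"
  unfolding Lp_norm_def
  by (subst nn_integral_torus_shift[of "\<lambda>x. ennreal (cmod (trig_poly R c x) powr p)"])
    (use assms in \<open>auto simp: trig_poly_periodic\<close>)

lemma sum_roots_of_unity:
  fixes j :: int and N :: nat
  assumes "\<bar>j\<bar> < int N"
  shows "(\<Sum>m<N. cis (of_int j * (2 * pi * real m / real N))) = (if j = 0 then of_nat N else 0)"
proof (cases "j = 0")
  case False
  have N: "N > 0" using assms by auto
  define z where "z = cis (2 * pi * of_int j / real N)"
  have zp: "cis (of_int j * (2 * pi * real m / real N)) = z ^ m" for m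
    by (simp add: z_def Complex.DeMoivre mult_ac)
  have zN: "z ^ N = 1"
    using cis_multiple_2pi[of "of_int j"] N by (simp add: z_def Complex.DeMoivre mult_ac)
  have "z \<noteq> 1"
  proof
    assume "z = 1"
    then have "cos (2 * pi * of_int j / real N) = 1"
      by (simp add: z_def complex_eq_iff)
    then obtain n :: int where "2 * pi * of_int j / real N = of_int n * 2 * pi"
      using cos_one_2pi_int by blast
    then have "real_of_int j = of_int n * real N"
      using N by (simp add: field_simps)
    then have "j = n * int N"
      by (metis of_int_eq_iff of_int_mult of_int_of_nat_eq)
    then have "int N dvd j" by simp
    then show False
      using assms False by (meson dvd_imp_le_int not_less abs_of_nat zdvd_not_zless abs_less_iff dvd_abs_iff zero_less_abs_iff)
  qed
  then show ?thesis
    unfolding zp using zN False by (simp add: geometric_sum)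
qed simp

text \<open>Fourier coefficients of the Fejer kernel of degree \<open>l - 1\<close>.\<close>

definition fejer_coeff :: "nat \<Rightarrow> int \<Rightarrow> real" where
  "fejer_coeff l k = max 0 (1 - of_int \<bar>k\<bar> / real l)"

text \<open>Counts the pairs with \<open>b - a = k\<close>, which is the coefficient at frequency
  \<open>k\<close>, up to sign, of the squared modulus of a sum of \<open>l\<close> consecutive
  characters.\<close>

lemma sum_shifted_pairs:
  fixes k :: int and l :: nat
  shows "(\<Sum>a<l. \<Sum>b<l. if int a - int b + k = 0 then 1 else 0) = max 0 (real l - of_int \<bar>k\<bar>)"
proof -
  have inner: "(\<Sum>b<l. if int a - int b + k = 0 then 1 else 0)
      = (if 0 \<le> int a + k \<and> int a + k < int l then 1 else (0::real))" for a
  proof -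
    have "(if int a - int b + k = 0 then 1 else (0::real))
        = (if b = nat (int a + k) then (if 0 \<le> int a + k then 1 else 0) else 0)" for b
      by auto
    then have "(\<Sum>b<l. if int a - int b + k = 0 then 1 else (0::real))
        = (if nat (int a + k) < l then (if 0 \<le> int a + k then 1 else 0) else 0)"
      by simp
    then show ?thesis by auto
  qed
  have "(\<Sum>a<l. if 0 \<le> int a + k \<and> int a + k < int l then 1 else (0::real))
      = real (card {a \<in> {..<l}. 0 \<le> int a + k \<and> int a + k < int l})"
    by (subst sum.inter_filter[symmetric]) auto
  also have "{a \<in> {..<l}. 0 \<le> int a + k \<and> int a + k < int l} = {nat (- k)..<min l (nat (int l - k))}"
    by auto
  also have "real (card \<dots>) = max 0 (real l - of_int \<bar>k\<bar>)"
    by (auto simp: max_def min_def abs_if of_nat_diff)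
  finally show ?thesis by (simp add: inner)
qed

text \<open>
  Discretising the Fejer kernel at the \<open>N\<close>-th roots of unity turns the multiplier into a convex
  combination of finitely many shifts.
\<close>

lemma fejer_average:
  fixes l N :: nat
  assumes l: "1 \<le> l"
  obtains w :: "nat \<Rightarrow> real" where "\<And>m. 0 \<le> w m"
    "\<And>k. \<bar>k\<bar> + int l \<le> int N \<Longrightarrow>
      (\<Sum>m<N. complex_of_real (w m) * cis (of_int k * (2 * pi * real m / real N)))
        = complex_of_real (fejer_coeff l k)"
proof -
  define t where "t m = 2 * pi * real m / real N" for m
  \<comment> \<open>The Fejer kernel sampled at the \<open>m\<close>-th node, with the weight
    \<open>1 / N\<close> of the quadrature; written as a squared modulus, it is visibly
    nonnegative.\<close>
  define w where "w m = (cmod (\<Sum>a<l. cis (real a * t m)))\<^sup>2 / (real N * real l)" for m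
  have w: "complex_of_real (w m)
      = (\<Sum>a<l. \<Sum>b<l. cis (of_int (int a - int b) * t m)) / (of_nat N * of_nat l)" for m
  proof -
    have "complex_of_real ((cmod (\<Sum>a<l. cis (real a * t m)))\<^sup>2)
        = (\<Sum>a<l. cis (real a * t m)) * cnj (\<Sum>a<l. cis (real a * t m))"
      by (rule complex_norm_square)
    also have "\<dots> = (\<Sum>a<l. \<Sum>b<l. cis (of_int (int a - int b) * t m))"
      by (simp add: cnj_sum sum_product cis_cnj cis_mult left_diff_distrib)
    finally show ?thesis by (simp add: w_def)
  qed
  show thesis
  proof
    show "0 \<le> w m" for m by (simp add: w_def)
    fix k :: int
    assume k: "\<bar>k\<bar> + int l \<le> int N"
    have N: "N > 0" using k l by linarith
    have "(\<Sum>m<N. complex_of_real (w m) * cis (of_int k * t m))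
        = (\<Sum>m<N. \<Sum>a<l. \<Sum>b<l. cis (of_int (int a - int b + k) * t m)) / (of_nat N * of_nat l)"
      by (simp add: w sum_divide_distrib sum_distrib_right cis_mult distrib_right)
    also have "(\<Sum>m<N. \<Sum>a<l. \<Sum>b<l. cis (of_int (int a - int b + k) * t m))
        = (\<Sum>a<l. \<Sum>b<l. \<Sum>m<N. cis (of_int (int a - int b + k) * t m))"
      by (subst sum.swap) (intro sum.cong refl sum.swap)
    also have "\<dots> = (\<Sum>a<l. \<Sum>b<l. if int a - int b + k = 0 then of_nat N else 0)"
    proof (intro sum.cong refl)
      fix a b assume "a \<in> {..<l}" "b \<in> {..<l}"
      \<comment> \<open>No aliasing: \<open>\<bar>a - b\<bar> \<le> l - 1\<close>, so
        \<open>\<bar>a - b + k\<bar> < N\<close> by the assumption on \<open>k\<close>.\<close>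
      then show "(\<Sum>m<N. cis (of_int (int a - int b + k) * t m))
          = (if int a - int b + k = 0 then of_nat N else 0)"
        unfolding t_def using k by (intro sum_roots_of_unity) auto
    qed
    also have "\<dots> = complex_of_real (real N * (\<Sum>a<l. \<Sum>b<l. if int a - int b + k = 0 then 1 else 0))"
      by (simp add: sum_distrib_left if_distrib of_real_sum cong: if_cong)
    also have "\<dots> / (of_nat N * of_nat l) = complex_of_real (max 0 (real l - of_int \<bar>k\<bar>) / real l)"
      unfolding sum_shifted_pairs using N by simp
    also have "max 0 (real l - of_int \<bar>k\<bar>) / real l = fejer_coeff l k"
      using l by (simp add: fejer_coeff_def max_def field_simps)
    finally show "(\<Sum>m<N. complex_of_real (w m) * cis (of_int k * (2 * pi * real m / real N)))
        = complex_of_real (fejer_coeff l k)"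
      by (simp add: t_def)
  qed
qed

text \<open>The spectrum \<open>R\<close> is arbitrary and \<open>K\<close> does not depend on it.
  The image is again written over \<open>R\<close>, so that bounds in different coordinates can be
  composed.\<close>

definition multiplier_bound :: "real \<Rightarrow> 'd :: finite \<Rightarrow> (int \<Rightarrow> real) \<Rightarrow> real \<Rightarrow> bool" where
  "multiplier_bound p j \<mu> K \<longleftrightarrow> (\<forall>(R :: (int ^ 'd) set) c. finite R \<longrightarrow>
     Lp_norm p (trig_poly R (\<lambda>k. c k * of_real (\<mu> (k $ j)))) \<le> ennreal K * Lp_norm p (trig_poly R c))"

lemma multiplier_bound_mono:
  assumes "multiplier_bound p j \<mu> K" "K \<le> K'"
  shows "multiplier_bound p j \<mu> K'"
  using assms unfolding multiplier_bound_def
  by (meson ennreal_leI mult_right_mono order_trans zero_le)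

text \<open>The multiplier is an average of translates in direction \<open>j\<close>, and translates
  have equal norms. The number of nodes depends on the spectrum, but the total weight is always
  1.\<close>

lemma multiplier_bound_fejer:
  fixes j :: "'d :: finite"
  assumes p: "1 \<le> p" and l: "1 \<le> l"
  shows "multiplier_bound p j (fejer_coeff l) 1"
  unfolding multiplier_bound_def
proof (intro allI impI)
  fix R :: "(int ^ 'd) set" and c
  assume R: "finite R"
  \<comment> \<open>The sum over \<open>R\<close> dominates each of its terms, so all frequencies of
    the polynomial satisfy the condition of \<open>fejer_average\<close>; it also makes sense for
    empty \<open>R\<close>.\<close>
  define N where "N = l + nat (\<Sum>k\<in>R. \<bar>k $ j\<bar>)"
  have N: "\<bar>k $ j\<bar> + int l \<le> int N" if "k \<in> R" for k
    using member_le_sum[OF that _ R, of "\<lambda>k. \<bar>k $ j\<bar>"] by (simp add: N_def)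
  have N0: "\<bar>0\<bar> + int l \<le> int N" "N > 0"
    using l by (auto simp: N_def sum_nonneg)
  obtain w where w0: "\<And>m. 0 \<le> w m" and w: "\<And>k. \<bar>k\<bar> + int l \<le> int N \<Longrightarrow>
      (\<Sum>m<N. complex_of_real (w m) * cis (of_int k * (2 * pi * real m / real N)))
        = complex_of_real (fejer_coeff l k)"
    by (rule fejer_average[OF l, of N]) (rule that)
  \<comment> \<open>The total weight is the multiplier at frequency 0.\<close>
  have sw: "(\<Sum>m<N. w m) = 1"
    using w[OF N0(1)] l by (simp add: fejer_coeff_def flip: of_real_sum)
  let ?f = "\<lambda>m x. trig_poly R c (x + axis j (2 * pi * real m / real N))"
  have "trig_poly R (\<lambda>k. c k * of_real (fejer_coeff l (k $ j))) = (\<lambda>x. \<Sum>m<N. of_real (w m) * ?f m x)"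
  proof
    fix x
    have "trig_poly R (\<lambda>k. c k * of_real (fejer_coeff l (k $ j))) x
      = (\<Sum>k\<in>R. c k * (\<Sum>m<N. of_real (w m) * cis (of_int (k $ j) * (2 * pi * real m / real N)))
            * char_exp k x)"
      unfolding trig_poly_def using w N by (intro sum.cong) auto
    also have "\<dots> = (\<Sum>k\<in>R. \<Sum>m<N. of_real (w m) *
        (c k * char_exp k (x + axis j (2 * pi * real m / real N))))"
      by (simp add: char_exp_add char_exp_axis sum_distrib_left sum_distrib_right mult_ac)
    also have "\<dots> = (\<Sum>m<N. of_real (w m) * ?f m x)"
      unfolding trig_poly_def by (subst sum.swap) (simp add: sum_distrib_left)
    finally show "trig_poly R (\<lambda>k. c k * of_real (fejer_coeff l (k $ j))) x
      = (\<Sum>m<N. of_real (w m) * ?f m x)" .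
  qed
  moreover have "Lp_norm p (\<lambda>x. \<Sum>m<N. of_real (w m) * ?f m x)
      \<le> ennreal (\<Sum>m<N. cmod (of_real (w m))) * Lp_norm p (trig_poly R c)"
  proof (rule Lp_norm_sum_le[OF p])
    fix m assume "m \<in> {..<N}"
    then show "Lp_norm p (?f m) \<le> Lp_norm p (trig_poly R c)"
      using N0 by (subst Lp_norm_trig_poly_shift) (auto simp: field_simps)
  qed auto
  ultimately show "Lp_norm p (trig_poly R (\<lambda>k. c k * of_real (fejer_coeff l (k $ j))))
      \<le> ennreal 1 * Lp_norm p (trig_poly R c)"
    using sw w0 by simp
qed

lemma multiplier_bound_lincomb:
  fixes j :: "'d :: finite"
  assumes p: "1 \<le> p" and 1: "multiplier_bound p j \<mu> K" and 2: "multiplier_bound p j \<mu>' K"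
  shows "multiplier_bound p j (\<lambda>k. a * \<mu> k + b * \<mu>' k) ((\<bar>a\<bar> + \<bar>b\<bar>) * K)"
  unfolding multiplier_bound_def
proof (intro allI impI)
  fix R :: "(int ^ 'd) set" and c
  assume R: "finite R"
  \<comment> \<open>The two terms are indexed by \<open>bool\<close>, so that the bound for finite
    sums applies.\<close>
  let ?f = "\<lambda>i. trig_poly R (\<lambda>k. c k * of_real (if i then \<mu> (k $ j) else \<mu>' (k $ j)))"
  have "trig_poly R (\<lambda>k. c k * of_real (a * \<mu> (k $ j) + b * \<mu>' (k $ j)))
    = (\<lambda>x. \<Sum>i\<in>UNIV. of_real (if i then a else b) * ?f i x)"
    by (auto simp: UNIV_bool trig_poly_def fun_eq_iff sum_distrib_left algebra_simps sum.distrib)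
  moreover have "Lp_norm p (\<lambda>x. \<Sum>i\<in>UNIV. of_real (if i then a else b) * ?f i x)
      \<le> ennreal (\<Sum>i\<in>UNIV. cmod (of_real (if i then a else b))) * (ennreal K * Lp_norm p (trig_poly R c))"
  proof (rule Lp_norm_sum_le[OF p])
    show "Lp_norm p (?f i) \<le> ennreal K * Lp_norm p (trig_poly R c)" for i
      using 1 2 R by (cases i) (simp_all add: multiplier_bound_def)
  qed auto
  moreover have "ennreal (\<Sum>i\<in>UNIV. cmod (of_real (if i then a else b))) = ennreal (\<bar>a\<bar> + \<bar>b\<bar>)"
    by (simp add: UNIV_bool)
  ultimately show "Lp_norm p (trig_poly R (\<lambda>k. c k * of_real (a * \<mu> (k $ j) + b * \<mu>' (k $ j))))
      \<le> ennreal ((\<bar>a\<bar> + \<bar>b\<bar>) * K) * Lp_norm p (trig_poly R c)"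
    by (simp add: ennreal_mult' mult.assoc)
qed

text \<open>The de la Vallee-Poussin kernel as twice the Fejer kernel of order \<open>2 * l\<close>
  minus that of order \<open>l\<close>; this gives the multiplier norm
  \<open>2 + 1 = 3\<close>.\<close>

definition VP_coeff :: "nat \<Rightarrow> int \<Rightarrow> real" where
  "VP_coeff l k = 2 * fejer_coeff (2 * l) k - fejer_coeff l k"

text \<open>The constant 1 subtracted for \<open>s = 1\<close> is the Fejer kernel of order 1. In
  all cases this is a difference of two multipliers of norm at most 3, whence the 6 below.\<close>

definition a_coeff :: "nat \<Rightarrow> int \<Rightarrow> real" where
  "a_coeff s k = VP_coeff (2 ^ s) k - (if s = 1 then fejer_coeff 1 k else VP_coeff (2 ^ (s - 1)) k)"

definition A_coeff :: "nat ^ 'd \<Rightarrow> int ^ 'd \<Rightarrow> real" where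
  "A_coeff s k = (\<Prod>j\<in>UNIV. a_coeff (s $ j) (k $ j))"

lemma multiplier_bound_VP:
  fixes j :: "'d :: finite"
  assumes p: "1 \<le> p" and l: "1 \<le> l"
  shows "multiplier_bound p j (VP_coeff l) 3"
  using multiplier_bound_lincomb[OF p multiplier_bound_fejer multiplier_bound_fejer, of "2 * l" l j 2 "- 1"] p l
  by (simp add: VP_coeff_def[abs_def])

lemma multiplier_bound_a:
  fixes j :: "'d :: finite"
  assumes p: "1 \<le> p"
  shows "multiplier_bound p j (a_coeff s) 6"
proof -
  have "multiplier_bound p j (\<lambda>k. if s = 1 then fejer_coeff 1 k else VP_coeff (2 ^ (s - 1)) k) 3"
    using multiplier_bound_mono[OF multiplier_bound_fejer[OF p, of 1 j], of 3]
      multiplier_bound_VP[OF p, of "2 ^ (s - 1)" j]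
    by (cases "s = 1") simp_all
  from multiplier_bound_lincomb[OF p multiplier_bound_VP[OF p] this, of "2 ^ s" 1 "- 1"]
  show ?thesis by (simp add: a_coeff_def[abs_def])
qed

text \<open>The multiplier is a product over coordinates, so the one-dimensional multipliers are
  applied one after another, each costing a factor 6.\<close>

lemma A_coeff_bound:
  fixes s :: "nat ^ 'd"
  assumes p: "1 \<le> p" and R: "finite R"
  shows "Lp_norm p (trig_poly R (\<lambda>k. c k * of_real (A_coeff s k)))
    \<le> ennreal (6 ^ CARD('d)) * Lp_norm p (trig_poly R c)"
proof -
  have "Lp_norm p (trig_poly R (\<lambda>k. c k * of_real (\<Prod>j\<in>S. a_coeff (s $ j) (k $ j))))
      \<le> ennreal (6 ^ card S) * Lp_norm p (trig_poly R c)" if "finite S" for S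
    using that
  proof (induction S rule: finite_induct)
    case (insert i S)
    let ?c = "\<lambda>k. c k * complex_of_real (\<Prod>j\<in>S. a_coeff (s $ j) (k $ j))"
    have "Lp_norm p (trig_poly R (\<lambda>k. ?c k * of_real (a_coeff (s $ i) (k $ i))))
        \<le> ennreal 6 * Lp_norm p (trig_poly R ?c)"
      by (rule multiplier_bound_a[OF p, of i "s $ i", unfolded multiplier_bound_def, rule_format, OF R])
    also have "\<dots> \<le> ennreal 6 * (ennreal (6 ^ card S) * Lp_norm p (trig_poly R c))"
      by (intro mult_left_mono insert.IH) simp
    also have "\<dots> = ennreal (6 ^ card (insert i S)) * Lp_norm p (trig_poly R c)"
      using insert by (simp add: ennreal_mult' mult.assoc)
    finally show ?case
      using insert by (simp add: mult_ac)
  qed simp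
  from this[of UNIV] show ?thesis by (simp add: A_coeff_def)
qed

section \<open>Dyadic blocks and the spectrum of the kernels\<close>

lemma finite_vec_set:
  fixes A :: "'d :: finite \<Rightarrow> 'a set"
  assumes "\<And>j. finite (A j)"
  shows "finite {k :: 'a ^ 'd. \<forall>j. k $ j \<in> A j}"
proof (rule finite_subset)
  show "{k :: 'a ^ 'd. \<forall>j. k $ j \<in> A j} \<subseteq> vec_lambda ` (PiE UNIV A)"
  proof
    fix k :: "'a ^ 'd"
    assume "k \<in> {k. \<forall>j. k $ j \<in> A j}"
    then show "k \<in> vec_lambda ` (PiE UNIV A)"
      by (intro image_eqI[of _ _ "\<lambda>j. k $ j"]) auto
  qed
  show "finite (vec_lambda ` (PiE UNIV A) :: ('a ^ 'd) set)"
    using assms by (intro finite_imageI finite_PiE) auto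
qed

lemma prod_sum_vec:
  fixes f :: "'d :: finite \<Rightarrow> 'a \<Rightarrow> 'c :: comm_semiring_1"
  assumes "\<And>j. finite (A j)"
  shows "(\<Prod>j\<in>UNIV. \<Sum>y\<in>A j. f j y) = (\<Sum>k | \<forall>j. k $ j \<in> A j. \<Prod>j\<in>UNIV. f j (k $ j))"
proof -
  have "(\<Prod>j\<in>UNIV. \<Sum>y\<in>A j. f j y) = (\<Sum>g\<in>PiE UNIV A. \<Prod>j\<in>UNIV. f j (g j))"
    using assms by (intro prod_sum_PiE) auto
  also have "\<dots> = (\<Sum>k | \<forall>j. k $ j \<in> A j. \<Prod>j\<in>UNIV. f j (k $ j))"
    by (rule sum.reindex_bij_witness[of _ "\<lambda>k j. k $ j" vec_lambda]) auto
  finally show ?thesis .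
qed

lemma sum_symmetric_cis:
  fixes v :: "int \<Rightarrow> real"
  assumes even: "\<And>k. v (- k) = v k"
  shows "(\<Sum>k = - int M..int M. of_real (v k) * cis (of_int k * t))
    = of_real (v 0 + 2 * (\<Sum>k = 1..M. v (int k) * cos (real k * t)))"
proof (induction M)
  case (Suc M)
  let ?f = "\<lambda>k. complex_of_real (v k) * cis (of_int k * t)"
  have "{- int (Suc M)..int (Suc M)} = insert (int (Suc M)) (insert (- int (Suc M)) {- int M..int M})"
    by auto
  then have "sum ?f {- int (Suc M)..int (Suc M)}
      = ?f (int (Suc M)) + (?f (- int (Suc M)) + sum ?f {- int M..int M})"
    by (simp del: of_nat_Suc)
  also have "?f (- int (Suc M)) = of_real (v (int (Suc M))) * cis (- (of_int (int (Suc M)) * t))"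
    by (simp only: even of_int_minus mult_minus_left)
  also have "?f (int (Suc M)) + (\<dots> + sum ?f {- int M..int M})
      = of_real (2 * (v (int (Suc M)) * cos (real (Suc M) * t))) + sum ?f {- int M..int M}"
    by (simp add: complex_eq_iff)
  finally show ?case
    using Suc.IH by (simp del: of_nat_Suc)
qed simp

lemma fejer_coeff_uminus [simp]: "fejer_coeff l (- k) = fejer_coeff l k"
  by (simp add: fejer_coeff_def)

lemma VP_coeff_uminus [simp]: "VP_coeff l (- k) = VP_coeff l k"
  by (simp add: VP_coeff_def)

lemma fejer_coeff_low:
  assumes "1 \<le> l" "\<bar>k\<bar> \<le> int l"
  shows "fejer_coeff l k = 1 - of_int \<bar>k\<bar> / real l"
proof -
  have "real_of_int \<bar>k\<bar> \<le> real l"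
    using assms by linarith
  then show ?thesis using assms by (simp add: fejer_coeff_def)
qed

lemma fejer_coeff_high:
  assumes "1 \<le> l" "int l \<le> \<bar>k\<bar>"
  shows "fejer_coeff l k = 0"
proof -
  have "real l \<le> real_of_int \<bar>k\<bar>"
    using assms by linarith
  then show ?thesis using assms by (simp add: fejer_coeff_def)
qed

lemma VP_coeff_low: "1 \<le> l \<Longrightarrow> \<bar>k\<bar> \<le> int l \<Longrightarrow> VP_coeff l k = 1"
  by (simp add: VP_coeff_def fejer_coeff_low)

lemma VP_coeff_high: "1 \<le> l \<Longrightarrow> 2 * int l \<le> \<bar>k\<bar> \<Longrightarrow> VP_coeff l k = 0"
  by (simp add: VP_coeff_def fejer_coeff_high)

lemma VP_coeff_mid:
  "1 \<le> l \<Longrightarrow> int l \<le> \<bar>k\<bar> \<Longrightarrow> \<bar>k\<bar> \<le> 2 * int l \<Longrightarrow> VP_coeff l k = 1 - (of_int \<bar>k\<bar> - real l) / real l"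
  by (simp add: VP_coeff_def fejer_coeff_low fejer_coeff_high diff_divide_distrib)

lemma fejer_coeff_one: "fejer_coeff (Suc 0) k = (if k = 0 then 1 else 0)"
  by (auto simp: fejer_coeff_def max_def)

text \<open>\<open>M\<close> may exceed the degree, so that one range serves both kernels of a
  difference and, later, all coordinates.\<close>

lemma VP_kernel_expansion:
  assumes l: "1 \<le> l" and M: "2 * l \<le> M"
  shows "complex_of_real (VP_kernel l t)
    = (\<Sum>k = - int M..int M. of_real (VP_coeff l k) * cis (of_int k * t))"
proof -
  let ?f = "\<lambda>k. VP_coeff l (int k) * cos (real k * t)"
  have "{1..M} = {1..l} \<union> {l + 1..2 * l - 1} \<union> {2 * l..M}"
    using l M by auto
  then have "sum ?f {1..M} = sum ?f ({1..l} \<union> {l + 1..2 * l - 1} \<union> {2 * l..M})"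
    by simp
  also have "\<dots> = sum ?f {1..l} + sum ?f {l + 1..2 * l - 1} + sum ?f {2 * l..M}"
    by (subst sum.union_disjoint; (subst sum.union_disjoint)?) auto
  also have "sum ?f {1..l} = (\<Sum>k = 1..l. cos (real k * t))"
    using l by (intro sum.cong) (auto simp: VP_coeff_low)
  also have "sum ?f {l + 1..2 * l - 1}
      = (\<Sum>k = l + 1..2 * l - 1. (1 - (real k - real l) / real l) * cos (real k * t))"
    using l by (intro sum.cong) (auto simp: VP_coeff_mid)
  also have "sum ?f {2 * l..M} = 0"
    using l by (intro sum.neutral) (auto simp: VP_coeff_high)
  finally have "VP_kernel l t = VP_coeff l 0 + 2 * sum ?f {1..M}"
    using l by (simp add: VP_kernel_def VP_coeff_low)
  then show ?thesis
    by (simp only: sum_symmetric_cis[of "VP_coeff l", OF VP_coeff_uminus])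
qed

lemma a_kernel_expansion:
  assumes s: "1 \<le> s" and M: "2 ^ (s + 1) \<le> M"
  shows "complex_of_real (a_kernel s t)
    = (\<Sum>k = - int M..int M. of_real (a_coeff s k) * cis (of_int k * t))"
proof -
  have 1: "complex_of_real (VP_kernel (2 ^ s) t)
    = (\<Sum>k = - int M..int M. of_real (VP_coeff (2 ^ s) k) * cis (of_int k * t))"
    using M by (intro VP_kernel_expansion) auto
  have "complex_of_real (if s = 1 then 1 else VP_kernel (2 ^ (s - 1)) t)
    = (\<Sum>k = - int M..int M. of_real (if s = 1 then fejer_coeff 1 k else VP_coeff (2 ^ (s - 1)) k)
        * cis (of_int k * t))"
  proof (cases "s = 1")
    case True
    have "(\<Sum>k = - int M..int M. of_real (fejer_coeff 1 k) * cis (of_int k * t))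
        = (\<Sum>k = - int M..int M. if k = 0 then 1 else 0)"
      by (intro sum.cong) (auto simp: fejer_coeff_one)
    then show ?thesis using True by simp
  next
    case False
    have "2 * 2 ^ (s - 1) \<le> M"
      using M s by (cases s) auto
    then show ?thesis
      using False VP_kernel_expansion[of "2 ^ (s - 1)" M t] by simp
  qed
  moreover have "a_kernel s t = VP_kernel (2 ^ s) t - (if s = 1 then 1 else VP_kernel (2 ^ (s - 1)) t)"
    by (simp add: a_kernel_def)
  ultimately show ?thesis
    using 1 by (simp add: a_coeff_def left_diff_distrib flip: sum_subtractf)
qed

text \<open>Below \<open>2 ^ (s - 1)\<close> both terms of the difference equal 1, and from
  \<open>2 ^ (s + 1)\<close> on both vanish. For \<open>s = 1\<close> the low range consists of
  \<open>k = 0\<close> alone.\<close>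

lemma a_coeff_nonzeroD:
  assumes s: "1 \<le> s" and nz: "a_coeff s k \<noteq> 0"
  shows "2 ^ (s - 1) \<le> \<bar>k\<bar>" "\<bar>k\<bar> < 2 ^ (s + 1)"
proof -
  have S: "(2::int) ^ s = 2 * 2 ^ (s - 1)" using s by (cases s) auto
  show "\<bar>k\<bar> < 2 ^ (s + 1)"
  proof (rule ccontr)
    assume "\<not> \<bar>k\<bar> < 2 ^ (s + 1)"
    then have k: "2 * 2 ^ s \<le> \<bar>k\<bar>" by simp
    have "VP_coeff (2 ^ s) k = 0"
      using k by (intro VP_coeff_high) auto
    moreover have "VP_coeff (2 ^ (s - 1)) k = 0"
    proof (rule VP_coeff_high)
      have "(0::int) \<le> 2 ^ (s - 1)" by simp
      then show "2 * int (2 ^ (s - 1)) \<le> \<bar>k\<bar>" using k S by simp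
    qed simp
    moreover have "k \<noteq> 0" using k by auto
    ultimately show False using nz by (auto simp: a_coeff_def fejer_coeff_one split: if_splits)
  qed
  show "2 ^ (s - 1) \<le> \<bar>k\<bar>"
  proof (rule ccontr)
    assume "\<not> 2 ^ (s - 1) \<le> \<bar>k\<bar>"
    then have k: "\<bar>k\<bar> < 2 ^ (s - 1)" by simp
    have "VP_coeff (2 ^ s) k = 1"
      using k S by (intro VP_coeff_low) auto
    moreover have "VP_coeff (2 ^ (s - 1)) k = 1"
      using k by (intro VP_coeff_low) auto
    moreover have "k = 0" if "s = 1" using k that by auto
    ultimately show False using nz by (auto simp: a_coeff_def fejer_coeff_one split: if_splits)
  qed
qed

text \<open>The coefficients of \<open>VP_kernel (2 ^ u)\<close> descend from 1 to 0 strictly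
  between consecutive powers of two. At powers of two they are therefore 0 or 1, and exactly one
  difference of consecutive kernels survives. This is why the extremal frequencies are powers of
  two.\<close>

lemma a_coeff_power_of_two:
  assumes s: "1 \<le> s" "1 \<le> m"
  shows "a_coeff s (2 ^ m) = (if s = m then 1 else 0)"
proof -
  have le: "(2::int) ^ u \<le> 2 ^ v" if "u \<le> v" for u v :: nat
    using that by (intro power_increasing) auto
  have VP: "VP_coeff (2 ^ u) (2 ^ m) = (if m \<le> u then 1 else 0)" for u
  proof (cases "m \<le> u")
    case True
    then show ?thesis using le[of m u] by (simp add: VP_coeff_low)
  next
    case False
    then show ?thesis using le[of "Suc u" m] by (simp add: VP_coeff_high)
  qed
  have f1: "fejer_coeff 1 (2 ^ m) = 0"
    by (simp add: fejer_coeff_one)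
  show ?thesis
    unfolding a_coeff_def VP f1 using s by auto
qed

lemma char_exp_prod: "char_exp k x = (\<Prod>j\<in>UNIV. cis (of_int (k $ j) * x $ j))"
  by (simp add: char_exp_def sum_distrib_left exp_sum cis_conv_exp mult_ac)

lemma A_kernel_expansion:
  fixes s :: "nat ^ 'd"
  assumes s: "s \<in> block_indices" and M: "\<And>j. 2 ^ (s $ j + 1) \<le> M"
  shows "A_kernel s x = trig_poly {k. \<forall>j. k $ j \<in> {- int M..int M}} (\<lambda>k. of_real (A_coeff s k)) x"
proof -
  have "A_kernel s x = (\<Prod>j\<in>UNIV. \<Sum>y\<in>{- int M..int M}. of_real (a_coeff (s $ j) y) * cis (of_int y * x $ j))"
    unfolding A_kernel_def of_real_prod
    using s M by (intro prod.cong a_kernel_expansion refl) (auto simp: block_indices_def)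
  also have "\<dots> = (\<Sum>k | \<forall>j. k $ j \<in> {- int M..int M}.
      \<Prod>j\<in>UNIV. of_real (a_coeff (s $ j) (k $ j)) * cis (of_int (k $ j) * x $ j))"
    by (rule prod_sum_vec) simp
  also have "\<dots> = trig_poly {k. \<forall>j. k $ j \<in> {- int M..int M}} (\<lambda>k. of_real (A_coeff s k)) x"
    by (simp add: trig_poly_def A_coeff_def char_exp_prod prod.distrib)
  finally show ?thesis .
qed

lemma finite_rho [simp]: "finite (rho s)"
proof (rule finite_subset)
  show "rho s \<subseteq> {k. \<forall>j. k $ j \<in> {- (2 ^ (s $ j))..2 ^ (s $ j)}}"
  proof
    fix k assume "k \<in> rho s"
    then have "\<bar>k $ j\<bar> < 2 ^ (s $ j)" for j
      by (auto simp: rho_def)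
    then show "k \<in> {k. \<forall>j. k $ j \<in> {- (2 ^ (s $ j))..2 ^ (s $ j)}}"
      by (simp add: abs_less_iff less_imp_le minus_le_iff)
  qed
qed (rule finite_vec_set, simp)

lemma dyadic_block_unique:
  fixes x :: int
  assumes "2 ^ (s - 1) \<le> x" "x < 2 ^ s" "2 ^ (s' - 1) \<le> x" "x < 2 ^ s'"
  shows "s = s'"
proof -
  have *: False if "u < v" "x < 2 ^ u" "2 ^ (v - 1) \<le> x" for u v :: nat
  proof -
    have "(2::int) ^ u \<le> 2 ^ (v - 1)"
      using that by (intro power_increasing) auto
    then show False using that by linarith
  qed
  show ?thesis
    using *[of s s'] *[of s' s] assms by (meson linorder_neqE_nat)
qed

lemma rho_disjoint: "k \<in> rho s \<Longrightarrow> k \<in> rho s' \<Longrightarrow> s = s'"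
  unfolding rho_def vec_eq_iff by (blast intro: dyadic_block_unique)

lemma rho_nonzero:
  assumes "k \<in> rho s"
  shows "k $ j \<noteq> 0"
proof
  assume "k $ j = 0"
  moreover have "2 ^ (s $ j - 1) \<le> \<bar>k $ j\<bar>" using assms by (auto simp: rho_def)
  moreover have "(0::int) < 2 ^ (s $ j - 1)" by simp
  ultimately show False by linarith
qed

definition neighbours :: "(nat ^ 'd) set" where
  "neighbours = {e. \<forall>j. e $ j \<in> {0, 1}}"

lemma finite_neighbours [simp]: "finite neighbours"
  unfolding neighbours_def by (rule finite_vec_set) simp

lemma neighbours_add: "s \<in> block_indices \<Longrightarrow> s + e \<in> block_indices"
  by (simp add: block_indices_def trans_le_add1)

lemma A_coeff_nonzeroD:
  assumes s: "s \<in> block_indices" and nz: "A_coeff s k \<noteq> 0"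
  shows "\<exists>e\<in>neighbours. k \<in> rho (s + e)"
proof
  let ?e = "(\<chi> j. if \<bar>k $ j\<bar> < 2 ^ (s $ j) then 0 else 1) :: nat ^ 'a"
  show "?e \<in> neighbours" by (simp add: neighbours_def)
  have "a_coeff (s $ j) (k $ j) \<noteq> 0" for j
    using nz by (simp add: A_coeff_def)
  then have "2 ^ (s $ j - 1) \<le> \<bar>k $ j\<bar>" "\<bar>k $ j\<bar> < 2 ^ (s $ j + 1)" for j
    using a_coeff_nonzeroD[of "s $ j" "k $ j"] s by (auto simp: block_indices_def)
  then show "k \<in> rho (s + ?e)"
    by (auto simp: rho_def not_less)
qed

section \<open>Fourier coefficients and block operators\<close>

lemma Lp_norm_eq_top_iff:
  assumes "0 < p"
  shows "Lp_norm p f = \<infinity> \<longleftrightarrow> (\<integral>\<^sup>+ x. ennreal (cmod (f x) powr p) \<partial>torus) = \<infinity>"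
  unfolding Lp_norm_def by (rule epowr_eq_top_iff)

lemma Lp_norm_const:
  fixes f :: "real ^ 'd \<Rightarrow> complex"
  assumes "0 < p" "0 \<le> C" "\<And>x. cmod (f x) = C"
  shows "Lp_norm p f = ennreal C"
  using assms by (simp add: Lp_norm_def emeasure_torus epowr_ennreal powr_powr)

lemma Lp_norm_cmult_char_exp:
  "0 < p \<Longrightarrow> Lp_norm p (\<lambda>x. c * char_exp k x) = ennreal (cmod c)"
  by (rule Lp_norm_const) (simp_all add: norm_mult)

lemma Lp_integrable:
  assumes p: "1 \<le> p" and f: "f \<in> Lp p"
  shows "integrable torus f"
proof (rule integrableI_bounded)
  have [measurable]: "f \<in> borel_measurable borel"
    using f by (simp add: Lp_def)
  show "f \<in> borel_measurable torus" by measurable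
  have "(\<integral>\<^sup>+ x. ennreal (norm (f x)) \<partial>torus) \<le> (\<integral>\<^sup>+ x. 1 + ennreal (cmod (f x) powr p) \<partial>torus)"
  proof (rule nn_integral_mono)
    fix x
    have "cmod (f x) \<le> 1 + cmod (f x) powr p"
    proof (cases "cmod (f x) \<le> 1")
      case False
      then have "cmod (f x) powr 1 \<le> cmod (f x) powr p"
        using p by (intro powr_mono) auto
      then show ?thesis using False by simp
    qed (simp add: add_increasing2)
    then have "ennreal (norm (f x)) \<le> ennreal (1 + cmod (f x) powr p)"
      by (rule ennreal_leI)
    then show "ennreal (norm (f x)) \<le> 1 + ennreal (cmod (f x) powr p)"
      by simp
  qed
  also have "\<dots> = 1 + (\<integral>\<^sup>+ x. ennreal (cmod (f x) powr p) \<partial>torus)"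
    by (subst nn_integral_add) (auto simp: emeasure_torus)
  also have "\<dots> < \<infinity>"
    using f p Lp_norm_eq_top_iff[of p f] by (auto simp: Lp_def less_top ennreal_add_less_top)
  finally show "(\<integral>\<^sup>+ x. ennreal (norm (f x)) \<partial>torus) < \<infinity>" .
qed

lemma trig_poly_Lp: "finite R \<Longrightarrow> 1 \<le> p \<Longrightarrow> trig_poly R c \<in> Lp p"
proof -
  assume R: "finite R" and p: "1 \<le> p"
  have "Lp_norm p (\<lambda>x. \<Sum>k\<in>R. c k * char_exp k x) \<le> ennreal (\<Sum>k\<in>R. cmod (c k)) * 1"
  proof (rule Lp_norm_sum_le[OF p R])
    show "Lp_norm p (char_exp k) \<le> 1" for k :: "int ^ 'a"
      using Lp_norm_cmult_char_exp[of p 1 k] p by simp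
  qed auto
  then have "Lp_norm p (trig_poly R c) < \<infinity>"
    by (simp add: trig_poly_def[abs_def] le_less_trans)
  then show ?thesis
    by (simp add: Lp_def periodic_def trig_poly_periodic)
qed

lemma Lp_diff:
  assumes p: "1 \<le> p" and f: "f \<in> Lp p" and g: "g \<in> Lp p"
  shows "(\<lambda>x. f x - g x) \<in> Lp p"
proof -
  have [measurable]: "f \<in> borel_measurable borel" "g \<in> borel_measurable borel"
    using f g by (auto simp: Lp_def)
  let ?h = "\<lambda>i. if i then f else g"
  have "Lp_norm p (\<lambda>x. \<Sum>i\<in>UNIV. (if i then 1 else - 1) * ?h i x)
      \<le> ennreal (\<Sum>i\<in>(UNIV::bool set). cmod (if i then 1 else - 1)) * max (Lp_norm p f) (Lp_norm p g)"
    by (intro Lp_norm_sum_le p) auto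
  also have "\<dots> < \<infinity>"
    using f g by (auto simp: Lp_def ennreal_mult_less_top max_def)
  finally have "Lp_norm p (\<lambda>x. f x - g x) < \<infinity>"
    by (simp add: UNIV_bool)
  then show ?thesis
    using f g by (auto simp: Lp_def periodic_def)
qed

lemma integrable_mult_char_exp:
  assumes "integrable torus f"
  shows "integrable torus (\<lambda>y. f y * char_exp k y)"
proof (rule Bochner_Integration.integrable_bound[OF assms])
  have [measurable]: "f \<in> borel_measurable torus" using assms by simp
  show "(\<lambda>y. f y * char_exp k y) \<in> borel_measurable torus" by measurable
qed (simp add: norm_mult)

lemma integrable_char_exp: "integrable (torus :: (real ^ 'd) measure) (char_exp k)"
proof -
  interpret finite_measure "torus :: (real ^ 'd) measure" by (rule finite_measure_torus)
  show ?thesis by (rule integrable_const_bound[of _ 1]) auto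
qed

lemma axis_zero: "axis j 0 = 0"
  by (simp add: vec_eq_iff axis_def)

text \<open>Adding 1 makes \<open>g\<close> nonnegative, which reduces the claim to the shift
  invariance of \<open>nn_integral\<close>.\<close>

lemma integral_torus_shift_real:
  fixes g :: "real ^ 'd \<Rightarrow> real"
  assumes [measurable]: "g \<in> borel_measurable borel" and bd: "\<And>x. \<bar>g x\<bar> \<le> 1"
    and per: "\<And>x. g (x + axis j (2 * pi)) = g x" and h: "0 \<le> h" "h < 2 * pi"
  shows "(LINT x|torus. g (x + axis j h)) = (LINT x|torus. g x)"
proof -
  interpret finite_measure "torus :: (real ^ 'd) measure" by (rule finite_measure_torus)
  have int: "integrable torus (\<lambda>x. g (x + axis j t))" for t
    by (rule integrable_const_bound[of _ 1]) (use bd in auto)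
  have bd': "0 \<le> g x + 1" for x
    using bd[of x] by linarith
  have eq: "(LINT x|torus. g (x + axis j t)) + measure (torus :: (real ^ 'd) measure) UNIV
      = enn2real (\<integral>\<^sup>+ x. ennreal (g (x + axis j t) + 1) \<partial>torus)" for t
  proof -
    have "(LINT x|torus. g (x + axis j t)) + measure (torus :: (real ^ 'd) measure) UNIV = (LINT x|torus. g (x + axis j t) + 1)"
      using int by simp
    also have "\<dots> = enn2real (\<integral>\<^sup>+ x. ennreal (g (x + axis j t) + 1) \<partial>torus)"
      by (rule integral_eq_nn_integral) (auto simp: bd')
    finally show ?thesis .
  qed
  have "(\<integral>\<^sup>+ x. ennreal (g (x + axis j h) + 1) \<partial>torus) = (\<integral>\<^sup>+ x. ennreal (g x + 1) \<partial>torus)"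
    by (rule nn_integral_torus_shift) (use per h in auto)
  then show ?thesis
    using eq[of h] eq[of 0] by (simp add: axis_zero)
qed

text \<open>A shift by \<open>pi / \<bar>k $ j\<bar>\<close> in a coordinate with
  \<open>k $ j \<noteq> 0\<close> changes the sign of the character, so its integral equals its own
  negative. No iterated integration is involved.\<close>

lemma integral_char_exp:
  "(LINT x|torus. char_exp k x) = (if k = 0 then 1 else 0)"
proof (cases "k = 0")
  case True
  then show ?thesis
    by (simp add: measure_def emeasure_torus)
next
  case False
  then obtain j where j: "k $ j \<noteq> 0" by (auto simp: vec_eq_iff)
  define h where "h = pi / of_int \<bar>k $ j\<bar>"
  have h: "0 \<le> h" "h < 2 * pi"
  proof -
    have "1 \<le> real_of_int \<bar>k $ j\<bar>" using j by linarith
    then have "h \<le> pi / 1" unfolding h_def by (intro divide_left_mono) auto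
    then show "h < 2 * pi" using pi_gt_zero by linarith
  qed (simp add: h_def)
  have kh: "of_int (k $ j) * h = (if k $ j > 0 then pi else - pi)"
    using j by (auto simp: h_def abs_if field_simps)
  have sh: "char_exp k (x + axis j h) = - char_exp k x" for x
  proof -
    have "cis (of_int (k $ j) * h) = - 1"
      unfolding kh by (simp add: complex_eq_iff)
    then show ?thesis by (simp add: char_exp_add char_exp_axis)
  qed
  have le1: "\<bar>Re (char_exp k x)\<bar> \<le> 1" "\<bar>Im (char_exp k x)\<bar> \<le> 1" for x
    using abs_Re_le_cmod[of "char_exp k x"] abs_Im_le_cmod[of "char_exp k x"] by simp_all
  have "(LINT x|torus. Re (char_exp k (x + axis j h))) = (LINT x|torus. Re (char_exp k x))"
    by (rule integral_torus_shift_real) (use le1 h in \<open>simp_all add: char_exp_periodic\<close>)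
  then have Re: "(LINT x|torus. Re (char_exp k x)) = 0"
    by (simp add: sh)
  have "(LINT x|torus. Im (char_exp k (x + axis j h))) = (LINT x|torus. Im (char_exp k x))"
    by (rule integral_torus_shift_real) (use le1 h in \<open>simp_all add: char_exp_periodic\<close>)
  then have Im: "(LINT x|torus. Im (char_exp k x)) = 0"
    by (simp add: sh)
  show ?thesis
    using Re Im False integrable_char_exp[of k]
    by (simp add: complex_eq_iff flip: integral_Re integral_Im)
qed

lemma fourier_coeff_trig_poly:
  assumes R: "finite R"
  shows "fourier_coeff (trig_poly R c) k = (if k \<in> R then c k else 0)"
proof -
  have "fourier_coeff (trig_poly R c) k = (LINT t|torus. (\<Sum>l\<in>R. c l * char_exp (l - k) t))"
    by (simp add: fourier_coeff_def trig_poly_def sum_distrib_right mult.assoc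
        flip: char_exp_add_index)
  also have "\<dots> = (\<Sum>l\<in>R. c l * (if l = k then 1 else 0))"
    by (subst Bochner_Integration.integral_sum) (auto simp: integrable_char_exp integral_char_exp)
  also have "\<dots> = (if k \<in> R then c k else 0)"
    using R by (simp add: if_distrib cong: if_cong)
  finally show ?thesis .
qed

lemma fourier_coeff_diff:
  assumes "integrable torus f" "integrable torus g"
  shows "fourier_coeff (\<lambda>x. f x - g x) k = fourier_coeff f k - fourier_coeff g k"
  unfolding fourier_coeff_def left_diff_distrib
  using assms by (intro Bochner_Integration.integral_diff integrable_mult_char_exp)

lemma fourier_sum_eq_trig_poly: "fourier_sum Q f = trig_poly Q (fourier_coeff f)"
  by (simp add: fun_eq_iff fourier_sum_def trig_poly_def)

lemma convolution_trig_poly: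
  assumes f: "integrable torus f" and R: "finite R"
  shows "convolution f (trig_poly R c) = trig_poly R (\<lambda>k. fourier_coeff f k * c k)"
proof
  fix x
  have i: "integrable torus (\<lambda>y. f y * char_exp (- k) y)" for k
    using f by (rule integrable_mult_char_exp)
  have "convolution f (trig_poly R c) x
      = (LINT y|torus. (\<Sum>k\<in>R. c k * char_exp k x * (f y * char_exp (- k) y)))"
    unfolding convolution_def trig_poly_def sum_distrib_left
    by (intro Bochner_Integration.integral_cong sum.cong refl)
      (simp add: diff_conv_add_uminus char_exp_add char_exp_uminus mult_ac del: add_uminus_conv_diff)
  also have "\<dots> = (\<Sum>k\<in>R. c k * char_exp k x * fourier_coeff f k)"
    using i by (subst Bochner_Integration.integral_sum) (auto simp: fourier_coeff_def)
  finally show "convolution f (trig_poly R c) x = trig_poly R (\<lambda>k. fourier_coeff f k * c k) x"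
    by (simp add: trig_poly_def mult_ac)
qed

lemma trig_poly_cong_support:
  assumes "finite R" "finite R'" "\<And>k. c k \<noteq> 0 \<Longrightarrow> k \<in> R \<longleftrightarrow> k \<in> R'"
  shows "trig_poly R c = trig_poly R' c"
proof
  fix x
  have "(\<Sum>k\<in>R. c k * char_exp k x) = (\<Sum>k\<in>R \<inter> R'. c k * char_exp k x)"
    using assms by (intro sum.mono_neutral_right) auto
  also have "\<dots> = (\<Sum>k\<in>R'. c k * char_exp k x)"
    using assms by (intro sum.mono_neutral_left) auto
  finally show "trig_poly R c x = trig_poly R' c x" by (simp add: trig_poly_def)
qed

text \<open>The kernel is first expanded over a cube of frequencies, with one \<open>M\<close> for
  all coordinates; the spectrum is then trimmed to the blocks that meet the support of
  \<open>A_coeff s\<close>.\<close>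

lemma A_block_eq:
  fixes s :: "nat ^ 'd"
  assumes s: "s \<in> block_indices" and f: "integrable torus f"
  shows "A_block s f
    = trig_poly (\<Union>e\<in>neighbours. rho (s + e)) (\<lambda>k. fourier_coeff f k * of_real (A_coeff s k))"
proof -
  define M where "M = (\<Sum>j\<in>UNIV. (2::nat) ^ (s $ j + 1))"
  have M: "2 ^ (s $ j + 1) \<le> M" for j
    unfolding M_def by (rule member_le_sum) auto
  let ?R = "{k :: int ^ 'd. \<forall>j. k $ j \<in> {- int M..int M}}"
  have R: "finite ?R" by (rule finite_vec_set) simp
  have "A_kernel s = trig_poly ?R (\<lambda>k. of_real (A_coeff s k))"
    using A_kernel_expansion[OF s M] by blast
  then have "A_block s f = trig_poly ?R (\<lambda>k. fourier_coeff f k * of_real (A_coeff s k))"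
    unfolding A_block_def by (simp only: convolution_trig_poly[OF f R])
  also have "\<dots> = trig_poly (\<Union>e\<in>neighbours. rho (s + e)) (\<lambda>k. fourier_coeff f k * of_real (A_coeff s k))"
  proof (rule trig_poly_cong_support[OF R])
    show "finite (\<Union>e\<in>neighbours. rho (s + e))" by simp
    fix k assume "fourier_coeff f k * of_real (A_coeff s k) \<noteq> 0"
    then have nz: "A_coeff s k \<noteq> 0" by simp
    have "k $ j \<in> {- int M..int M}" for j
    proof -
      have "a_coeff (s $ j) (k $ j) \<noteq> 0" using nz by (simp add: A_coeff_def)
      then have "\<bar>k $ j\<bar> < 2 ^ (s $ j + 1)"
        using s by (intro a_coeff_nonzeroD) (auto simp: block_indices_def)
      also have "\<dots> \<le> int M"
        using M[of j] by (metis of_nat_le_iff of_nat_numeral of_nat_power)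
      finally show ?thesis by auto
    qed
    then show "k \<in> ?R \<longleftrightarrow> k \<in> (\<Union>e\<in>neighbours. rho (s + e))"
      using A_coeff_nonzeroD[OF s nz] by auto
  qed
  finally show ?thesis .
qed

lemma integral_cis_period:
  fixes m :: int
  assumes "m \<noteq> 0"
  shows "(LINT t:{0..2 * pi}|lborel. cis (of_int m * t)) = 0"
    and "set_integrable lborel {0..2 * pi} (\<lambda>t. cis (of_int m * t))"
proof -
  have c: "continuous_on {0..2 * pi} (\<lambda>t. cis (of_int m * t))"
    by (intro continuous_intros)
  show "set_integrable lborel {0..2 * pi} (\<lambda>t. cis (of_int m * t))"
    using c by (rule borel_integrable_atLeastAtMost')
  let ?F = "\<lambda>t. cis (of_int m * t) / (\<i> * of_int m)"
  have "(?F has_vector_derivative cis (of_int m * t)) (at t within {0..2 * pi})" for t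
  proof -
    have "((\<lambda>z. exp (\<i> * of_int m * z) / (\<i> * of_int m)) has_field_derivative
        exp (\<i> * of_int m * of_real t)) (at (of_real t))"
      using assms by (auto intro!: derivative_eq_intros)
    from has_vector_derivative_real_field[OF this, of "{0..2 * pi}"] show ?thesis
      by (simp add: cis_conv_exp mult.assoc)
  qed
  then have "integral\<^sup>L lborel (\<lambda>t. indicator {0..2 * pi} t *\<^sub>R cis (of_int m * t)) = ?F (2 * pi) - ?F 0"
    using c by (intro integral_FTC_atLeastAtMost) auto
  also have "\<dots> = 0"
    using cis_multiple_2pi[of "of_int m"] by (simp add: mult_ac)
  finally show "(LINT t:{0..2 * pi}|lborel. cis (of_int m * t)) = 0"
    by (simp add: set_lebesgue_integral_def)
qed

text \<open>On a line in direction \<open>j\<close> each character is a constant times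
  \<open>cis (k $ j * t)\<close>, where \<open>x0\<close> is the point of the line with
  \<open>j\<close>-th coordinate 0. Frequencies in blocks have no zero coordinate.\<close>

lemma section_trig_poly:
  fixes R :: "(int ^ 'd) set"
  assumes R: "finite R" and nz: "\<And>k. k \<in> R \<Longrightarrow> k $ j \<noteq> 0"
  shows "(LINT t:{0..2 * pi}|lborel. trig_poly R c (\<chi> i. if i = j then t else x $ i)) = 0"
    and "set_integrable lborel {0..2 * pi} (\<lambda>t. trig_poly R c (\<chi> i. if i = j then t else x $ i))"
proof -
  define x0 where "x0 = (\<chi> i. if i = j then 0 else x $ i)"
  have "(\<chi> i. if i = j then t else x $ i) = x0 + axis j t" for t
    by (simp add: x0_def vec_eq_iff axis_def)
  then have eq: "trig_poly R c (\<chi> i. if i = j then t else x $ i)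
      = (\<Sum>k\<in>R. c k * char_exp k x0 * cis (of_int (k $ j) * t))" for t
    by (simp add: trig_poly_def char_exp_add char_exp_axis mult.assoc)
  have i: "set_integrable lborel {0..2 * pi} (\<lambda>t. c k * char_exp k x0 * cis (of_int (k $ j) * t))"
    if "k \<in> R" for k
    using integral_cis_period(2)[OF nz[OF that]] by (rule set_integrable_mult_right)
  show "set_integrable lborel {0..2 * pi} (\<lambda>t. trig_poly R c (\<chi> i. if i = j then t else x $ i))"
    unfolding eq using i by (simp add: set_integrable_def scaleR_sum_right)
  show "(LINT t:{0..2 * pi}|lborel. trig_poly R c (\<chi> i. if i = j then t else x $ i)) = 0"
  proof -
    have "(LINT t:{0..2 * pi}|lborel. trig_poly R c (\<chi> i. if i = j then t else x $ i))
        = (\<Sum>k\<in>R. LINT t:{0..2 * pi}|lborel. c k * char_exp k x0 * cis (of_int (k $ j) * t))"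
      unfolding eq set_lebesgue_integral_def scaleR_sum_right
      using i by (intro Bochner_Integration.integral_sum) (simp add: set_integrable_def)
    then show ?thesis
      using nz by (simp add: integral_cis_period)
  qed
qed

lemma trig_poly_Lp0:
  assumes "finite R" "\<And>k j. k \<in> R \<Longrightarrow> k $ j \<noteq> 0" "1 \<le> p"
  shows "trig_poly R c \<in> Lp0 p"
  using assms by (simp add: Lp0_def trig_poly_Lp section_trig_poly)

text \<open>
  Sections of \<open>f\<close> that are not integrable need no separate treatment: subtracting the bounded
  section of a trigonometric polynomial leaves them non-integrable, and both integrals have the
  junk value 0.
\<close>

lemma Lp0_diff_trig_poly:
  assumes f: "f \<in> Lp0 p" and R: "finite R" and nz: "\<And>k j. k \<in> R \<Longrightarrow> k $ j \<noteq> 0" and p: "1 \<le> p"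
  shows "(\<lambda>x. f x - trig_poly R c x) \<in> Lp0 p"
proof -
  have "AE x in torus. (LINT t:{0..2 * pi}|lborel. f (\<chi> i. if i = j then t else x $ i)
      - trig_poly R c (\<chi> i. if i = j then t else x $ i)) = 0" for j
  proof -
    have "AE x in torus. (LINT t:{0..2 * pi}|lborel. f (\<chi> i. if i = j then t else x $ i)) = 0"
      using f by (simp add: Lp0_def)
    then show ?thesis
    proof (rule AE_mp, intro AE_I2 impI)
      fix x
      let ?f = "\<lambda>t. f (\<chi> i. if i = j then t else x $ i)"
      let ?t = "\<lambda>t. trig_poly R c (\<chi> i. if i = j then t else x $ i)"
      assume 0: "(LINT t:{0..2 * pi}|lborel. ?f t) = 0"
      have t: "(LINT t:{0..2 * pi}|lborel. ?t t) = 0" "set_integrable lborel {0..2 * pi} ?t"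
        using R nz by (auto intro: section_trig_poly)
      show "(LINT t:{0..2 * pi}|lborel. ?f t - ?t t) = 0"
      proof (cases "set_integrable lborel {0..2 * pi} ?f")
        case True
        then show ?thesis using 0 t by (simp add: set_integral_diff)
      next
        case False
        have "\<not> set_integrable lborel {0..2 * pi} (\<lambda>t. ?f t - ?t t)"
        proof
          assume "set_integrable lborel {0..2 * pi} (\<lambda>t. ?f t - ?t t)"
          from set_integral_add(1)[OF this t(2)] show False using False by simp
        qed
        then show ?thesis
          unfolding set_integrable_def set_lebesgue_integral_def by (rule not_integrable_integral_eq)
      qed
    qed
  qed
  then show ?thesis
    using f R p by (auto simp: Lp0_def intro!: Lp_diff trig_poly_Lp)
qed

section \<open>Sums over the complement of the hyperbolic cross\<close>

text \<open>Uses \<open>2 powr x - 1 \<ge> x * ln 2\<close>. The explicit dependence on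
  \<open>x\<close> matters: it is later applied with \<open>x\<close> of order \<open>1 / n\<close>,
  and this is where the powers of \<open>n\<close> come from.\<close>

lemma geometric_sum_powr_le:
  fixes x :: real
  assumes x: "0 < x"
  shows "(\<Sum>u = 1..M. 2 powr - (x * real u)) \<le> 1 / (x * ln 2)"
proof -
  define q where "q = 2 powr - x"
  have q: "0 < q" "q < 1" using x by (auto simp: q_def powr_less_one)
  have "(\<Sum>u = 1..M. 2 powr - (x * real u)) = (\<Sum>u = 1..M. q ^ u)"
    by (intro sum.cong) (auto simp: q_def powr_powr mult_ac simp flip: powr_realpow)
  also have "\<dots> = q * (\<Sum>u<M. q ^ u)"
    by (simp add: sum_distrib_left sum.atLeast1_atMost_eq)
  also have "\<dots> \<le> q * (1 / (1 - q))"
    using q by (intro mult_left_mono) (auto simp: sum_gp_strict divide_right_mono)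
  also have "\<dots> = 1 / (2 powr x - 1)"
    using q x by (simp add: q_def powr_minus field_simps)
  also have "\<dots> \<le> 1 / (x * ln 2)"
  proof (rule divide_left_mono)
    have "1 + x * ln 2 \<le> exp (x * ln 2)" by (rule exp_ge_add_one_self)
    then show "x * ln 2 \<le> 2 powr x - 1" by (simp add: powr_def algebra_simps)
    then show "0 < (2 powr x - 1) * (x * ln 2)" using x by (intro mult_pos_pos) (auto intro: gr_one_powr)
  qed simp
  finally show ?thesis .
qed

text \<open>The smallest \<open>u\<close> gives the largest term, at most
  \<open>2 powr - (\<alpha> * L)\<close>. Relative to it the others form part of a geometric series
  in \<open>u - k\<close>, whose zeroth term is the 1 in the constant.\<close>

lemma geometric_tail_powr_le:
  fixes \<alpha> W L :: real and U :: "nat set"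
  assumes \<alpha>: "0 < \<alpha>" and U: "finite U" and L: "\<And>u. u \<in> U \<Longrightarrow> L \<le> real u + W"
  shows "(\<Sum>u\<in>U. 2 powr - (\<alpha> * (real u + W))) \<le> (1 + 1 / (\<alpha> * ln 2)) * 2 powr - (\<alpha> * L)"
proof (cases "U = {}")
  case True
  then show ?thesis using \<alpha> by simp
next
  case False
  define k where "k = Min U"
  have k: "k \<in> U" "\<And>u. u \<in> U \<Longrightarrow> k \<le> u"
    using U False by (auto simp: k_def)
  let ?h = "\<lambda>v. 2 powr - (\<alpha> * real v)"
  have "(\<Sum>u\<in>U. 2 powr - (\<alpha> * (real u + W))) = (\<Sum>u\<in>U. 2 powr - (\<alpha> * (real k + W)) * ?h (u - k))"
    using k by (intro sum.cong) (auto simp: of_nat_diff algebra_simps simp flip: powr_add)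
  also have "\<dots> = 2 powr - (\<alpha> * (real k + W)) * (\<Sum>v\<in>(\<lambda>u. u - k) ` U. ?h v)"
  proof -
    have "inj_on (\<lambda>u. u - k) U"
      using k by (intro inj_onI) (metis le_add_diff_inverse2)
    then show ?thesis by (simp add: sum.reindex sum_distrib_left)
  qed
  also have "\<dots> \<le> 2 powr - (\<alpha> * L) * (1 + 1 / (\<alpha> * ln 2))"
  proof (rule mult_mono)
    show "2 powr - (\<alpha> * (real k + W)) \<le> 2 powr - (\<alpha> * L)"
      using L[OF k(1)] \<alpha> by (intro powr_mono) auto
    have "(\<Sum>v\<in>(\<lambda>u. u - k) ` U. ?h v) \<le> (\<Sum>v\<in>insert 0 {1..Max U}. ?h v)"
    proof (rule sum_mono2)
      show "(\<lambda>u. u - k) ` U \<subseteq> insert 0 {1..Max U}"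
      proof
        fix v assume "v \<in> (\<lambda>u. u - k) ` U"
        then obtain u where "u \<in> U" "v = u - k" by auto
        then have "v \<le> Max U" using U Max_ge[of U u] by linarith
        then show "v \<in> insert 0 {1..Max U}" by auto
      qed
    qed auto
    also have "\<dots> = 1 + (\<Sum>v = 1..Max U. ?h v)" by simp
    also have "\<dots> \<le> 1 + 1 / (\<alpha> * ln 2)"
      using geometric_sum_powr_le[OF \<alpha>] by simp
    finally show "(\<Sum>v\<in>(\<lambda>u. u - k) ` U. ?h v) \<le> 1 + 1 / (\<alpha> * ln 2)" .
  qed (auto intro: sum_nonneg)
  finally show ?thesis by (simp add: mult.commute)
qed

text \<open>
  The coordinate \<open>i0\<close> is summed first, as a geometric series. What remains is the weight
  \<open>2 powr - (\<alpha> * max n W)\<close>, which is estimated by \<open>2 * 2 powr - (\<alpha> * n) * 2 powr - (\<beta> * W)\<close> with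
  \<open>\<beta> = min \<alpha> (1 / n)\<close> (Rankin's trick); this factorises over the other coordinates, and each
  coordinate in \<open>V\<close> contributes a factor of order \<open>n\<close>.
\<close>

lemma sum_weight_tail:
  fixes r g :: "real ^ 'd" and V :: "'d set" and r0 \<tau> :: real
  assumes i0: "i0 \<in> V" and r0: "0 < r0" and \<tau>: "0 < \<tau>"
    and V_all: "\<forall>j\<in>V. r $ j = r0 \<and> g $ j = 1"
    and off_all: "\<forall>j\<in>- V. 1 < g $ j \<and> r0 * g $ j < r $ j"
  shows "\<exists>C>0. \<forall>n\<ge>1. \<forall>G. finite G \<longrightarrow> G \<subseteq> {s \<in> block_indices. real n \<le> weight s g} \<longrightarrow>
    (\<Sum>s\<in>G. 2 powr - (\<tau> * weight s r)) \<le> C * 2 powr - (\<tau> * r0 * real n) * real n ^ (card V - 1)"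
proof -
  have V: "r $ j = r0 \<and> g $ j = 1" if "j \<in> V" for j using V_all that by blast
  have off: "1 < g $ j \<and> r0 * g $ j < r $ j" if "j \<notin> V" for j using off_all that by blast
  define \<alpha> where "\<alpha> = \<tau> * r0"
  have \<alpha>: "0 < \<alpha>" using r0 \<tau> by (simp add: \<alpha>_def)
  \<comment> \<open>The excess of the weight over its multiple on the cross:
    \<open>\<tau> * weight s r\<close> is \<open>\<tau> * r0 * weight s g\<close> plus the sum of
    \<open>e j * s $ j\<close>.\<close>
  define e where "e j = \<tau> * (r $ j - r0 * g $ j)" for j
  have e0: "e j = 0" if "j \<in> V" for j using V[OF that] by (simp add: e_def)
  have epos: "0 < e j" if "j \<notin> V" for j using off[OF that] \<tau> by (simp add: e_def)
  have g1: "1 \<le> g $ j" for j using V[of j] off[of j] by (cases "j \<in> V") auto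
  \<comment> \<open>\<open>1 / \<beta>\<close> is the larger of \<open>1 / \<alpha>\<close> and
    \<open>n\<close>, hence at most \<open>(1 / \<alpha> + 1) * n\<close>; the factor
    \<open>ln 2\<close> comes from the geometric series.\<close>
  define D where "D = (1 / \<alpha> + 1) / ln 2"
  have D: "0 < D" using \<alpha> by (simp add: D_def add_pos_pos)
  define P where "P = (\<Prod>j\<in>- V. 1 / (e j * ln 2))"
  have P: "0 < P" unfolding P_def using epos by (intro prod_pos) auto
  define C1 where "C1 = 1 + 1 / (\<alpha> * ln 2)"
  have C1: "0 < C1" using \<alpha> by (simp add: C1_def add_pos_pos)
  define C where "C = C1 * 2 * (D ^ (card V - 1) * P)"
  show ?thesis
  proof (intro exI[of _ C] conjI allI impI)
    show "0 < C" using C1 D P by (simp add: C_def)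
    fix n :: nat and G :: "(nat ^ 'd) set"
    assume n: "1 \<le> n" and G: "finite G" "G \<subseteq> {s \<in> block_indices. real n \<le> weight s g}"
    define \<beta> where "\<beta> = min \<alpha> (1 / real n)"
    have \<beta>: "0 < \<beta>" "\<beta> \<le> \<alpha>" "\<beta> * real n \<le> 1"
      using \<alpha> n by (auto simp: \<beta>_def min_def field_simps)
    have \<beta>D: "1 / (\<beta> * ln 2) \<le> D * real n"
    proof -
      have "1 / \<beta> \<le> (1 / \<alpha> + 1) * real n"
      proof (cases "\<alpha> \<le> 1 / real n")
        case True
        then have "1 / \<beta> = 1 / \<alpha>" by (simp add: \<beta>_def)
        also have "\<dots> \<le> (1 / \<alpha> + 1) * 1" by simp
        also have "\<dots> \<le> (1 / \<alpha> + 1) * real n" using n \<alpha> by (intro mult_left_mono) auto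
        finally show ?thesis .
      next
        case False
        then have "1 / \<beta> = real n" by (simp add: \<beta>_def)
        also have "\<dots> \<le> (1 / \<alpha> + 1) * real n" using \<alpha> by (simp add: field_simps)
        finally show ?thesis .
      qed
      then have "1 / \<beta> / ln 2 \<le> (1 / \<alpha> + 1) * real n / ln 2" by (intro divide_right_mono) auto
      then show ?thesis by (simp add: D_def)
    qed
    define W where "W s = (\<Sum>j\<in>- {i0}. g $ j * real (s $ j))" for s :: "nat ^ 'd"
    define E where "E s = (\<Sum>j\<in>- {i0}. e j * real (s $ j))" for s :: "nat ^ 'd"
    define h where "h j u = 2 powr - ((if j = i0 then 0 else \<beta> * g $ j + e j) * real u)" for j and u :: nat
    \<comment> \<open>Erases the coordinate \<open>i0\<close>: the fibres of \<open>er\<close> are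
      lines in this direction, and \<open>W\<close> and \<open>E\<close> are constant on
      them.\<close>
    define er where "er s = (\<chi> j. if j = i0 then 0 else s $ j)" for s :: "nat ^ 'd"
    have erWE: "W (er s) = W s" "E (er s) = E s" for s
      unfolding W_def E_def er_def by (auto intro!: sum.cong)
    have split: "(\<Sum>j\<in>UNIV. f j) = f i0 + (\<Sum>j\<in>- {i0}. f j)" for f :: "'d \<Rightarrow> real"
      by (simp add: sum.remove[of UNIV i0] Compl_eq_Diff_UNIV)
    have wg: "weight s g = real (s $ i0) + W s" for s
      using V[OF i0] by (simp add: weight_def W_def split mult.commute)
    have wr: "\<tau> * weight s r = \<alpha> * (real (s $ i0) + W s) + E s" for s
    proof -
      have "\<tau> * weight s r = \<tau> * r0 * real (s $ i0) + (\<Sum>j\<in>- {i0}. \<tau> * r $ j * real (s $ j))"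
        using V[OF i0] by (simp add: weight_def split distrib_left sum_distrib_left mult_ac)
      also have "(\<Sum>j\<in>- {i0}. \<tau> * r $ j * real (s $ j)) = \<alpha> * W s + E s"
        unfolding W_def E_def sum_distrib_left sum.distrib[symmetric]
        by (intro sum.cong) (auto simp: e_def \<alpha>_def algebra_simps)
      finally show ?thesis by (simp add: \<alpha>_def algebra_simps)
    qed
    have fibre: "(\<Sum>s | s \<in> G \<and> er s = t. 2 powr - (\<tau> * weight s r))
        \<le> C1 * 2 * 2 powr - (\<alpha> * real n) * (\<Prod>j\<in>UNIV. h j (t $ j))" for t
    proof -
      let ?F = "{s \<in> G. er s = t}"
      have inj: "inj_on (\<lambda>s. s $ i0) ?F"
      proof (rule inj_onI)
        fix s s' assume "s \<in> ?F" "s' \<in> ?F" and eq: "s $ i0 = s' $ i0"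
        then have "er s = er s'" by simp
        then show "s = s'"
          using eq unfolding vec_eq_iff er_def by (auto split: if_splits)
      qed
      have "(\<Sum>s\<in>?F. 2 powr - (\<tau> * weight s r))
          = (\<Sum>s\<in>?F. 2 powr - (\<alpha> * (real (s $ i0) + W t)) * 2 powr - E t)"
        by (intro sum.cong) (auto simp: wr erWE simp flip: powr_add)
      also have "\<dots> = (\<Sum>u\<in>(\<lambda>s. s $ i0) ` ?F. 2 powr - (\<alpha> * (real u + W t))) * 2 powr - E t"
        by (simp add: sum.reindex[OF inj] sum_distrib_right)
      also have "\<dots> \<le> C1 * 2 powr - (\<alpha> * max (real n) (W t)) * 2 powr - E t"
        unfolding C1_def
      proof (intro mult_right_mono geometric_tail_powr_le \<alpha>)
        fix u assume "u \<in> (\<lambda>s. s $ i0) ` ?F"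
        then obtain s where s: "s \<in> G" "er s = t" "u = s $ i0" by auto
        then have "real n \<le> weight s g" using G by auto
        then show "max (real n) (W t) \<le> real u + W t"
          using s erWE(1)[of s] by (simp add: wg)
      qed (use G in auto)
      also have "\<dots> \<le> C1 * (2 * 2 powr - (\<alpha> * real n) * 2 powr - (\<beta> * W t)) * 2 powr - E t"
      proof (intro mult_right_mono mult_left_mono)
        \<comment> \<open>For \<open>W t \<le> n\<close> the last term on the right only helps, and
          beyond \<open>n\<close> the comparison uses \<open>\<beta> \<le> \<alpha>\<close>. Then
          \<open>\<beta> * n \<le> 1\<close> limits the loss to the factor 2.\<close>
        have "- (\<alpha> * max (real n) (W t)) \<le> - (\<alpha> * real n) - \<beta> * (W t - real n)"
        proof (cases "W t \<le> real n")
          case True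
          then have "\<beta> * (W t - real n) \<le> 0" using \<beta> by (simp add: mult_le_0_iff)
          then show ?thesis using True by simp
        next
          case False
          then have "\<beta> * (W t - real n) \<le> \<alpha> * (W t - real n)" using \<beta> by (intro mult_right_mono) auto
          then show ?thesis using False by (simp add: algebra_simps)
        qed
        also have "\<dots> \<le> 1 - \<alpha> * real n - \<beta> * W t" using \<beta> by (simp add: algebra_simps)
        finally have "2 powr - (\<alpha> * max (real n) (W t)) \<le> 2 powr (1 + - (\<alpha> * real n) + - (\<beta> * W t))"
          by (intro powr_mono) auto
        also have "\<dots> = 2 * 2 powr - (\<alpha> * real n) * 2 powr - (\<beta> * W t)"
          by (simp only: powr_add powr_one)
        finally show "2 powr - (\<alpha> * max (real n) (W t)) \<le> 2 * 2 powr - (\<alpha> * real n) * 2 powr - (\<beta> * W t)" .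
      qed (use C1 in auto)
      also have "\<dots> = C1 * 2 * 2 powr - (\<alpha> * real n) * 2 powr (- (\<beta> * W t) + - E t)"
        by (simp only: powr_add mult_ac)
      also have "2 powr (- (\<beta> * W t) + - E t) = (\<Prod>j\<in>UNIV. h j (t $ j))"
      proof -
        have "- (\<beta> * W t) + - E t = (\<Sum>j\<in>UNIV. - ((if j = i0 then 0 else \<beta> * g $ j + e j) * real (t $ j)))"
          unfolding split W_def E_def sum_distrib_left
          by (simp add: sum_negf[symmetric] sum.distrib[symmetric] algebra_simps)
        then show ?thesis
          by (simp add: h_def powr_sum)
      qed
      finally show ?thesis .
    qed
    define M where "M = Max (insert 0 ((\<lambda>(s, j). s $ j) ` (G \<times> UNIV)))"
    have M: "s $ j \<le> M" if "s \<in> G" for s j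
      unfolding M_def using G that by (intro Max_ge) (auto intro!: image_eqI[of _ _ "(s, j)"])
    define A where "A j = (if j = i0 then {0} else {1..M})" for j
    have "(\<Sum>s\<in>G. 2 powr - (\<tau> * weight s r))
        = (\<Sum>t\<in>er ` G. \<Sum>s | s \<in> G \<and> er s = t. 2 powr - (\<tau> * weight s r))"
      by (rule sum.image_gen[OF G(1)])
    also have "\<dots> \<le> (\<Sum>t\<in>er ` G. C1 * 2 * 2 powr - (\<alpha> * real n) * (\<Prod>j\<in>UNIV. h j (t $ j)))"
      by (intro sum_mono fibre)
    also have "\<dots> = C1 * 2 * 2 powr - (\<alpha> * real n) * (\<Sum>t\<in>er ` G. \<Prod>j\<in>UNIV. h j (t $ j))"
      by (simp add: sum_distrib_left)
    also have "\<dots> \<le> C1 * 2 * 2 powr - (\<alpha> * real n) * ((D * real n) ^ (card V - 1) * P)"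
    proof (rule mult_left_mono)
      have "(\<Sum>t\<in>er ` G. \<Prod>j\<in>UNIV. h j (t $ j)) \<le> (\<Sum>t | \<forall>j. t $ j \<in> A j. \<Prod>j\<in>UNIV. h j (t $ j))"
      proof (rule sum_mono2)
        show "finite {t :: nat ^ 'd. \<forall>j. t $ j \<in> A j}" by (rule finite_vec_set) (simp add: A_def)
        show "er ` G \<subseteq> {t. \<forall>j. t $ j \<in> A j}"
          using M G by (auto simp: er_def A_def block_indices_def)
      qed (auto simp: h_def intro!: prod_nonneg)
      also have "\<dots> = (\<Prod>j\<in>UNIV. \<Sum>u\<in>A j. h j u)"
        by (rule prod_sum_vec[symmetric]) (simp add: A_def)
      also have "\<dots> \<le> (\<Prod>j\<in>UNIV. if j = i0 then 1 else if j \<in> V then D * real n else 1 / (e j * ln 2))"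
      proof (rule prod_mono, rule conjI)
        fix j :: 'd
        show "0 \<le> (\<Sum>u\<in>A j. h j u)" by (intro sum_nonneg) (simp add: h_def)
        consider "j = i0" | "j \<noteq> i0" "j \<in> V" | "j \<notin> V" by blast
        then show "(\<Sum>u\<in>A j. h j u) \<le> (if j = i0 then 1 else if j \<in> V then D * real n else 1 / (e j * ln 2))"
        proof cases
          case 1
          then show ?thesis by (simp add: A_def h_def)
        next
          case 2
          then have "(\<Sum>u\<in>A j. h j u) = (\<Sum>u = 1..M. 2 powr - (\<beta> * real u))"
            using V[of j] e0[of j] by (simp add: A_def h_def)
          also have "\<dots> \<le> 1 / (\<beta> * ln 2)" using \<beta> by (intro geometric_sum_powr_le)
          finally show ?thesis using 2 \<beta>D by simp
        next
          case 3
          then have j: "j \<noteq> i0" using i0 by auto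
          \<comment> \<open>Dropping the nonnegative \<open>\<beta> * g $ j\<close> leaves the rate
            \<open>e j > 0\<close>, so the bound is free of \<open>n\<close>.\<close>
          have "(\<Sum>u\<in>A j. h j u) \<le> (\<Sum>u = 1..M. 2 powr - (e j * real u))"
            unfolding A_def h_def using j \<beta> g1[of j]
            by (auto intro!: sum_mono powr_mono mult_right_mono)
          also have "\<dots> \<le> 1 / (e j * ln 2)" using epos[OF 3] by (intro geometric_sum_powr_le)
          finally show ?thesis using 3 j by simp
        qed
      qed
      also have "\<dots> = (\<Prod>j\<in>V - {i0}. D * real n) * P"
      proof -
        let ?b = "\<lambda>j. if j = i0 then 1 else if j \<in> V then D * real n else 1 / (e j * ln 2)"
        have "prod ?b UNIV = prod ?b (insert i0 ((V - {i0}) \<union> - V))"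
          by (rule prod.cong) auto
        also have "\<dots> = ?b i0 * prod ?b ((V - {i0}) \<union> - V)"
          using i0 by (intro prod.insert) auto
        also have "prod ?b ((V - {i0}) \<union> - V) = prod ?b (V - {i0}) * prod ?b (- V)"
          by (rule prod.union_disjoint) auto
        also have "prod ?b (- V) = P" unfolding P_def using i0 by (intro prod.cong) auto
        also have "prod ?b (V - {i0}) = (\<Prod>j\<in>V - {i0}. D * real n)" by (intro prod.cong) auto
        finally show ?thesis by simp
      qed
      also have "\<dots> = (D * real n) ^ (card V - 1) * P"
        using i0 by simp
      finally show "(\<Sum>t\<in>er ` G. \<Prod>j\<in>UNIV. h j (t $ j)) \<le> (D * real n) ^ (card V - 1) * P" .
    qed (use C1 in simp)
    also have "\<dots> = C * 2 powr - (\<tau> * r0 * real n) * real n ^ (card V - 1)"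
      by (simp add: C_def \<alpha>_def power_mult_distrib)
    finally show "(\<Sum>s\<in>G. 2 powr - (\<tau> * weight s r))
      \<le> C * 2 powr - (\<tau> * r0 * real n) * real n ^ (card V - 1)" .
  qed
qed

text \<open>After division of the weights by \<open>L\<close>, Young's inequality is applied term by
  term, and the two halves add up to \<open>1 / t + 1 / q = 1\<close>.\<close>

lemma Holder_sum_le:
  fixes b w :: "'a \<Rightarrow> real" and t :: real
  assumes t: "1 < t" and b: "\<And>i. i \<in> G \<Longrightarrow> 0 \<le> b i" and w: "\<And>i. i \<in> G \<Longrightarrow> 0 \<le> w i"
    and B: "(\<Sum>i\<in>G. b i powr t) \<le> 1" and W: "(\<Sum>i\<in>G. w i powr (t / (t - 1))) \<le> L powr (t / (t - 1))"
    and L: "0 < L"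
  shows "(\<Sum>i\<in>G. b i * w i) \<le> L"
proof -
  define q where "q = t / (t - 1)"
  have q: "1 < q" "1 / t + 1 / q = 1" using t by (auto simp: q_def field_simps)
  have "(\<Sum>i\<in>G. b i * w i) = L * (\<Sum>i\<in>G. b i * (w i / L))"
    using L by (simp add: sum_distrib_left)
  also have "\<dots> \<le> L * (\<Sum>i\<in>G. b i powr t / t + (w i / L) powr q / q)"
    using t q b w L by (intro mult_left_mono sum_mono Youngs_inequality) auto
  also have "(\<Sum>i\<in>G. b i powr t / t + (w i / L) powr q / q)
      = (\<Sum>i\<in>G. b i powr t) / t + (\<Sum>i\<in>G. w i powr q) / L powr q / q"
    using w L by (simp add: sum.distrib sum_divide_distrib powr_divide)
  also have "\<dots> \<le> 1 / t + 1 / q"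
    using B W q t L by (intro add_mono divide_right_mono) (auto simp: q_def divide_le_eq_1)
  finally show ?thesis using L q by simp
qed

section \<open>The upper bound\<close>

lemma sum_le_infsum_ennreal:
  fixes f :: "'a \<Rightarrow> ennreal"
  assumes "finite F" "F \<subseteq> A"
  shows "sum f F \<le> infsum f A"
proof -
  have "infsum f F \<le> infsum f A"
    using assms by (intro infsum_mono_neutral nonneg_summable_on_complete) auto
  then show ?thesis using assms by simp
qed

lemma one_div_ennreal: "0 < t \<Longrightarrow> enn2real (1 / ennreal t) = 1 / t"
  using divide_ennreal[of 1 t] by simp

lemma Lp_norm_delta:
  assumes "1 \<le> p"
  shows "Lp_norm p (delta s f) = ennreal (enn2real (Lp_norm p (delta s f)))"
proof -
  have "delta s f \<in> Lp p"
    unfolding delta_def fourier_sum_eq_trig_poly using assms by (intro trig_poly_Lp) auto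
  then show ?thesis by (simp add: Lp_def)
qed

lemma B_norm_le_one_infsumD:
  assumes \<theta>: "\<theta> = ennreal t" "1 \<le> t" and B: "B_norm r p \<theta> f \<le> 1"
  shows "(\<Sum>\<^sub>\<infinity>s\<in>block_indices. ennreal (2 powr (weight s r * t)) * epowr (Lp_norm p (delta s f)) t) \<le> 1"
    (is "?X \<le> 1")
proof -
  have "epowr ?X (1 / t) \<le> 1"
    using B \<theta> by (simp add: B_norm_def)
  then have "epowr (epowr ?X (1 / t)) t \<le> epowr 1 t"
    using \<theta> by (intro epowr_mono) auto
  moreover have "epowr 1 t = 1"
    using epowr_ennreal[of 1 t] by simp
  ultimately show ?thesis
    using \<theta> by (simp add: epowr_epowr)
qed

text \<open>The conjugate exponent forces three cases: termwise bounds for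
  \<open>\<theta> = \<infinity>\<close>, the largest weight for \<open>\<theta> = 1\<close>, and
  Hoelder otherwise. Since \<open>enn2real (1 / \<theta>)\<close> is 0, 1 or \<open>1 / t\<close>,
  one formula covers them all.\<close>

lemma class_tail_sum:
  fixes r g :: "real ^ 'd" and V :: "'d set" and r0 p :: real and \<theta> :: ennreal
  assumes p: "1 \<le> p" and \<theta>: "1 \<le> \<theta>" and i0: "i0 \<in> V" and r0: "0 < r0"
    and V_all: "\<forall>j\<in>V. r $ j = r0 \<and> g $ j = 1"
    and off_all: "\<forall>j\<in>- V. 1 < g $ j \<and> r0 * g $ j < r $ j"
  shows "\<exists>C>0. \<forall>n\<ge>1. \<forall>f\<in>B_class r p \<theta>. \<forall>G. finite G \<longrightarrow>
    G \<subseteq> {s \<in> block_indices. real n \<le> weight s g} \<longrightarrow>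
    (\<Sum>s\<in>G. Lp_norm p (delta s f))
      \<le> ennreal (C * (2 powr (- real n * r0) * real n powr ((real (card V) - 1) * (1 - enn2real (1 / \<theta>)))))"
proof -
  have V: "r $ j = r0 \<and> g $ j = 1" if "j \<in> V" for j using V_all that by blast
  have off: "1 < g $ j \<and> r0 * g $ j < r $ j" if "j \<notin> V" for j using off_all that by blast
  have cV: "1 \<le> card V" using i0 by (simp add: Suc_le_eq card_gt_0_iff) auto
  have npow: "real n ^ (card V - 1) = real n powr (real (card V) - 1)" if "1 \<le> n" for n
    using that cV powr_realpow[of "real n" "card V - 1"] by (simp add: of_nat_diff)
  define c where "c f s = enn2real (Lp_norm p (delta s f))" for f :: "real ^ 'd \<Rightarrow> complex" and s
  have c0: "0 \<le> c f s" for f s by (simp add: c_def)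
  have Lc: "Lp_norm p (delta s f) = ennreal (c f s)" for f s
    unfolding c_def by (rule Lp_norm_delta[OF p])
  have sumc: "(\<Sum>s\<in>G. Lp_norm p (delta s f)) = ennreal (\<Sum>s\<in>G. c f s)" for G f
    by (simp add: Lc c0)
  consider "\<theta> = \<infinity>" | "\<theta> = 1" | t where "\<theta> = ennreal t" "1 < t"
  proof (cases \<theta>)
    case (real t)
    with \<theta> have "1 \<le> t" by (metis ennreal_1 ennreal_le_iff)
    then show ?thesis using real that by (cases "t = 1") auto
  qed (use that in auto)
  then show ?thesis
  proof cases
    case 1
    obtain C where C: "0 < C" and le: "\<forall>n\<ge>1. \<forall>G. finite G \<longrightarrow>
        G \<subseteq> {s \<in> block_indices. real n \<le> weight s g} \<longrightarrow>
        (\<Sum>s\<in>G. 2 powr - (1 * weight s r)) \<le> C * 2 powr - (1 * r0 * real n) * real n ^ (card V - 1)"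
      using sum_weight_tail[OF i0 r0 zero_less_one V_all off_all] by (elim exE conjE) (rule that)
    show ?thesis
    proof (intro exI[of _ C] conjI allI impI ballI C)
      fix n :: nat and f and G :: "(nat ^ 'd) set"
      assume n: "1 \<le> n" and f: "f \<in> B_class r p \<theta>"
        and G: "finite G" "G \<subseteq> {s \<in> block_indices. real n \<le> weight s g}"
      have "c f s \<le> 2 powr - weight s r" if "s \<in> G" for s
      proof -
        have "ennreal (2 powr weight s r) * Lp_norm p (delta s f) \<le> 1"
          using f 1 G that by (auto simp: B_class_def B_norm_def SUP_le_iff)
        then have "2 powr weight s r * c f s \<le> 1"
          using c0[of f s] by (simp add: Lc ennreal_le_1 flip: ennreal_mult)
        then show ?thesis by (simp add: powr_minus field_simps)
      qed
      then have "(\<Sum>s\<in>G. c f s) \<le> (\<Sum>s\<in>G. 2 powr - (1 * weight s r))"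
        by (intro sum_mono) simp
      also have "\<dots> \<le> C * 2 powr - (1 * r0 * real n) * real n powr (real (card V) - 1)"
        unfolding npow[OF n, symmetric] by (rule le[rule_format, OF n G])
      finally show "(\<Sum>s\<in>G. Lp_norm p (delta s f)) \<le> ennreal (C * (2 powr (- real n * r0)
          * real n powr ((real (card V) - 1) * (1 - enn2real (1 / \<theta>)))))"
        unfolding sumc using 1 n by (intro ennreal_leI) (simp add: mult_ac)
    qed
  next
    case 2
    have wr: "r0 * weight s g \<le> weight s r" for s
    proof -
      have "r0 * g $ j \<le> r $ j" for j using V[of j] off[of j] by (cases "j \<in> V") auto
      then have "real (s $ j) * (r0 * g $ j) \<le> real (s $ j) * r $ j" for j
        by (intro mult_left_mono) auto
      then show ?thesis unfolding weight_def sum_distrib_left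
        by (intro sum_mono) (simp add: mult_ac)
    qed
    show ?thesis
    proof (intro exI[of _ 1] conjI allI impI ballI zero_less_one)
      fix n :: nat and f and G :: "(nat ^ 'd) set"
      assume n: "1 \<le> n" and f: "f \<in> B_class r p \<theta>"
        and G: "finite G" "G \<subseteq> {s \<in> block_indices. real n \<le> weight s g}"
      have "(\<Sum>s\<in>G. ennreal (2 powr (weight s r * 1)) * epowr (Lp_norm p (delta s f)) 1)
          \<le> (\<Sum>\<^sub>\<infinity>s\<in>block_indices. ennreal (2 powr (weight s r * 1)) * epowr (Lp_norm p (delta s f)) 1)"
        using G by (intro sum_le_infsum_ennreal) auto
      also have "\<dots> \<le> 1"
        using f 2 by (intro B_norm_le_one_infsumD[of \<theta>]) (auto simp: B_class_def)
      finally have "ennreal (\<Sum>s\<in>G. 2 powr weight s r * c f s) \<le> 1"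
        using c0[of f] by (simp add: Lc flip: ennreal_mult)
      then have b: "(\<Sum>s\<in>G. 2 powr weight s r * c f s) \<le> 1" by (simp add: ennreal_le_1)
      have "(\<Sum>s\<in>G. c f s) = (\<Sum>s\<in>G. 2 powr - weight s r * (2 powr weight s r * c f s))"
        by (simp add: powr_minus flip: mult.assoc)
      \<comment> \<open>On the tail, \<open>weight s r \<ge> r0 * weight s g \<ge> r0 * n\<close>,
        so the whole rate can be taken out of the sum.\<close>
      also have "\<dots> \<le> (\<Sum>s\<in>G. 2 powr (- real n * r0) * (2 powr weight s r * c f s))"
      proof (intro sum_mono mult_right_mono powr_mono)
        fix s assume "s \<in> G"
        then have "r0 * real n \<le> r0 * weight s g" using G r0 by (intro mult_left_mono) auto
        then show "- weight s r \<le> - real n * r0" using wr[of s] by (simp add: mult.commute)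
      qed (use c0 in auto)
      also have "\<dots> \<le> 2 powr (- real n * r0) * 1"
        unfolding sum_distrib_left[symmetric] by (intro mult_left_mono b) simp
      finally show "(\<Sum>s\<in>G. Lp_norm p (delta s f)) \<le> ennreal (1 * (2 powr (- real n * r0)
          * real n powr ((real (card V) - 1) * (1 - enn2real (1 / \<theta>)))))"
        unfolding sumc using 2 n by (intro ennreal_leI) simp
    qed
  next
    case (3 t)
    define q where "q = t / (t - 1)"
    have q: "0 < q" "1 / q = 1 - 1 / t" using 3 by (auto simp: q_def field_simps)
    obtain C where C: "0 < C" and le: "\<forall>n\<ge>1. \<forall>G. finite G \<longrightarrow>
        G \<subseteq> {s \<in> block_indices. real n \<le> weight s g} \<longrightarrow>
        (\<Sum>s\<in>G. 2 powr - (q * weight s r)) \<le> C * 2 powr - (q * r0 * real n) * real n ^ (card V - 1)"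
      using sum_weight_tail[OF i0 r0 q(1) V_all off_all] by (elim exE conjE) (rule that)
    show ?thesis
    proof (intro exI[of _ "C powr (1 / q)"] conjI allI impI ballI)
      show "0 < C powr (1 / q)" using C by simp
      fix n :: nat and f and G :: "(nat ^ 'd) set"
      assume n: "1 \<le> n" and f: "f \<in> B_class r p \<theta>"
        and G: "finite G" "G \<subseteq> {s \<in> block_indices. real n \<le> weight s g}"
      \<comment> \<open>The \<open>q\<close>-th root of the bound on the sum of
        \<open>2 powr - (q * weight s r)\<close>; its power of \<open>n\<close> has exponent
        \<open>(card V - 1) / q\<close>, and \<open>1 / q = 1 - 1 / t\<close>.\<close>
      define L where "L = C powr (1 / q) *
        (2 powr (- real n * r0) * real n powr ((real (card V) - 1) * (1 / q)))"
      have L: "0 < L" using C n by (simp add: L_def)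
      have "(\<Sum>s\<in>G. ennreal (2 powr (weight s r * t)) * epowr (Lp_norm p (delta s f)) t)
          \<le> (\<Sum>\<^sub>\<infinity>s\<in>block_indices. ennreal (2 powr (weight s r * t)) * epowr (Lp_norm p (delta s f)) t)"
        using G by (intro sum_le_infsum_ennreal) auto
      also have "\<dots> \<le> 1"
        using f 3 by (intro B_norm_le_one_infsumD[of \<theta>]) (auto simp: B_class_def)
      also have "(\<Sum>s\<in>G. ennreal (2 powr (weight s r * t)) * epowr (Lp_norm p (delta s f)) t)
          = ennreal (\<Sum>s\<in>G. (2 powr weight s r * c f s) powr t)"
        using c0[of f] by (simp add: Lc epowr_ennreal powr_mult powr_powr flip: ennreal_mult)
      finally have b: "(\<Sum>s\<in>G. (2 powr weight s r * c f s) powr t) \<le> 1" by (simp add: ennreal_le_1)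
      have "(\<Sum>s\<in>G. c f s) = (\<Sum>s\<in>G. (2 powr weight s r * c f s) * 2 powr - weight s r)"
        by (intro sum.cong) (auto simp: powr_minus)
      also have "\<dots> \<le> L"
      proof (rule Holder_sum_le[OF \<open>1 < t\<close> _ _ b _ L], unfold q_def[symmetric])
        have "(\<Sum>s\<in>G. (2 powr - weight s r) powr q) = (\<Sum>s\<in>G. 2 powr - (q * weight s r))"
          by (simp add: powr_powr mult.commute)
        also have "\<dots> \<le> C * 2 powr - (q * r0 * real n) * real n ^ (card V - 1)"
          by (rule le[rule_format, OF n G])
        also have "\<dots> = L powr q"
          unfolding npow[OF n] L_def using C n q(1) by (simp add: powr_mult powr_powr mult_ac)
        finally show "(\<Sum>s\<in>G. (2 powr - weight s r) powr q) \<le> L powr q" .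
      qed (use c0 in auto)
      finally show "(\<Sum>s\<in>G. Lp_norm p (delta s f)) \<le> ennreal (C powr (1 / q) * (2 powr (- real n * r0)
          * real n powr ((real (card V) - 1) * (1 - enn2real (1 / \<theta>)))))"
        unfolding sumc using 3 by (intro ennreal_leI) (simp add: L_def q one_div_ennreal)
    qed
  qed
qed

lemma finite_low_blocks:
  fixes g :: "real ^ 'd"
  assumes g: "\<And>j. 1 \<le> g $ j"
  shows "finite {s \<in> block_indices. weight s g < real n}"
proof (rule finite_subset)
  show "{s \<in> block_indices. weight s g < real n} \<subseteq> {s. \<forall>j. s $ j \<in> {..n}}"
  proof (intro subsetI CollectI allI)
    fix s j assume s: "s \<in> {s \<in> block_indices. weight s g < real n}"
    have g0: "0 \<le> g $ i" for i using g[of i] by linarith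
    have "real (s $ j) * 1 \<le> real (s $ j) * g $ j" by (intro mult_left_mono g) simp
    also have "\<dots> \<le> weight s g"
      unfolding weight_def by (rule member_le_sum) (auto simp: g0)
    also have "\<dots> < real n" using s by simp
    finally show "s $ j \<in> {..n}" by simp
  qed
qed (rule finite_vec_set, simp)

lemma finite_hyp_cross:
  fixes g :: "real ^ 'd"
  assumes "\<And>j. 1 \<le> g $ j"
  shows "finite (hyp_cross g n)"
  unfolding hyp_cross_def using finite_low_blocks[OF assms] by simp

lemma hyp_cross_nonzero: "k \<in> hyp_cross g n \<Longrightarrow> k $ j \<noteq> 0"
  by (auto simp: hyp_cross_def rho_nonzero)

lemma rho_hyp_cross_iff:
  assumes "s \<in> block_indices" "k \<in> rho s"
  shows "k \<in> hyp_cross g n \<longleftrightarrow> weight s g < real n"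
  using assms by (auto simp: hyp_cross_def dest: rho_disjoint)

lemma weight_add: "weight (s + e) g = weight s g + weight e g"
  by (simp add: weight_def distrib_right sum.distrib)

text \<open>The image under \<open>A_block s\<close> splits into its pieces on the blocks
  \<open>rho (s + e)\<close>. On each of them the remainder coincides with \<open>f\<close> or
  vanishes, depending only on the weight of \<open>s + e\<close>.\<close>

lemma A_block_remainder_le:
  fixes g :: "real ^ 'd" and n :: nat
  assumes p: "1 \<le> p" and s: "s \<in> block_indices" and f: "f \<in> Lp p" and g: "\<And>j. 1 \<le> g $ j"
  defines "Q \<equiv> hyp_cross g n"
  shows "Lp_norm p (A_block s (\<lambda>x. f x - fourier_sum Q f x))
    \<le> ennreal (real (card (neighbours :: (nat ^ 'd) set))) * (ennreal (6 ^ CARD('d)) *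
      (\<Sum>e\<in>neighbours. if real n \<le> weight (s + e) g then Lp_norm p (delta (s + e) f) else 0))"
proof -
  let ?N = "neighbours :: (nat ^ 'd) set"
  let ?T = "\<lambda>s. if real n \<le> weight s g then Lp_norm p (delta s f) else 0"
  have Q: "finite Q" unfolding Q_def by (rule finite_hyp_cross[OF g])
  define h where "h = (\<lambda>x. f x - trig_poly Q (fourier_coeff f) x)"
  have tQ: "trig_poly Q (fourier_coeff f) \<in> Lp p" using Q p by (rule trig_poly_Lp)
  have ih: "integrable torus h"
    unfolding h_def by (intro Lp_integrable[OF p] Lp_diff p f tQ)
  have ch: "fourier_coeff h k = (if k \<in> Q then 0 else fourier_coeff f k)" for k
    unfolding h_def using Lp_integrable[OF p f] Lp_integrable[OF p tQ]
    by (simp add: fourier_coeff_diff fourier_coeff_trig_poly[OF Q])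
  define F where "F e = trig_poly (rho (s + e)) (\<lambda>k. fourier_coeff h k * of_real (A_coeff s k))" for e
  have "A_block s h = (\<lambda>x. \<Sum>e\<in>?N. 1 * F e x)"
    unfolding A_block_eq[OF s ih] F_def trig_poly_def
    by (rule ext, simp, rule sum.UNION_disjoint) (auto dest: rho_disjoint)
  moreover have "Lp_norm p (\<lambda>x. \<Sum>e\<in>?N. 1 * F e x)
      \<le> ennreal (\<Sum>e\<in>?N. cmod 1) * (ennreal (6 ^ CARD('d)) * (\<Sum>e\<in>?N. ?T (s + e)))"
  proof (rule Lp_norm_sum_le[OF p])
    fix e :: "nat ^ 'd" assume e: "e \<in> ?N"
    show "F e \<in> borel_measurable borel" by (simp add: F_def)
    have se: "s + e \<in> block_indices" using s by (rule neighbours_add)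
    have "Lp_norm p (F e) \<le> ennreal (6 ^ CARD('d)) * ?T (s + e)"
    proof (cases "real n \<le> weight (s + e) g")
      case True
      have "F e = trig_poly (rho (s + e)) (\<lambda>k. fourier_coeff f k * of_real (A_coeff s k))"
        unfolding F_def trig_poly_def using True
        by (intro ext sum.cong) (auto simp: ch Q_def rho_hyp_cross_iff[OF se])
      then show ?thesis
        using True A_coeff_bound[OF p finite_rho, of "s + e" "fourier_coeff f" s]
        by (simp add: delta_def fourier_sum_eq_trig_poly)
    next
      case False
      have "F e = (\<lambda>x. 0)"
        unfolding F_def trig_poly_def using False
        by (intro ext sum.neutral) (auto simp: ch Q_def rho_hyp_cross_iff[OF se])
      then show ?thesis using p Lp_norm_const[of p 0 "F e"] by simp
    qed
    \<comment> \<open>One term is replaced by the whole sum because \<open>Lp_norm_sum_le\<close>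
      asks for a common bound; this costs the factor \<open>card neighbours\<close>.\<close>
    also have "\<dots> \<le> ennreal (6 ^ CARD('d)) * (\<Sum>e\<in>?N. ?T (s + e))"
      using e by (intro mult_left_mono member_le_sum) auto
    finally show "Lp_norm p (F e) \<le> ennreal (6 ^ CARD('d)) * (\<Sum>e\<in>?N. ?T (s + e))" .
  qed simp
  ultimately show ?thesis
    by (simp add: h_def fourier_sum_eq_trig_poly)
qed

text \<open>The factor \<open>m\<close> occurs twice in the constant: once from splitting each
  \<open>A_block s\<close> into pieces, once from summing over the shifts \<open>e\<close>.\<close>

lemma fourier_approx_upper:
  fixes r g :: "real ^ 'd" and V :: "'d set" and r0 p :: real and \<theta> :: ennreal
  assumes p: "1 \<le> p" and \<theta>: "1 \<le> \<theta>" and i0: "i0 \<in> V" and r0: "0 < r0"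
    and V_all: "\<forall>j\<in>V. r $ j = r0 \<and> g $ j = 1"
    and off_all: "\<forall>j\<in>- V. 1 < g $ j \<and> r0 * g $ j < r $ j"
  shows "\<exists>C>0. \<forall>n\<ge>1. fourier_approx (hyp_cross g n) (B_class r p \<theta>) (Bq1_norm p)
    \<le> ennreal (C * (2 powr (- real n * r0) * real n powr ((real (card V) - 1) * (1 - enn2real (1 / \<theta>)))))"
proof -
  have V: "r $ j = r0 \<and> g $ j = 1" if "j \<in> V" for j using V_all that by blast
  have off: "1 < g $ j \<and> r0 * g $ j < r $ j" if "j \<notin> V" for j using off_all that by blast
  let ?N = "neighbours :: (nat ^ 'd) set"
  define R where "R n = 2 powr (- real n * r0) * real n powr ((real (card V) - 1) * (1 - enn2real (1 / \<theta>)))"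
    for n
  obtain C where C: "0 < C" and tail: "\<forall>n\<ge>1. \<forall>f\<in>B_class r p \<theta>. \<forall>G. finite G \<longrightarrow>
      G \<subseteq> {s \<in> block_indices. real n \<le> weight s g} \<longrightarrow>
      (\<Sum>s\<in>G. Lp_norm p (delta s f)) \<le> ennreal (C * R n)"
    using class_tail_sum[OF assms, folded R_def] by (elim exE conjE) (rule that)
  have g1: "1 \<le> g $ j" for j using V[of j] off[of j] by (cases "j \<in> V") auto
  define m where "m = real (card ?N)"
  have "?N \<noteq> {}" by (auto simp: neighbours_def intro: exI[of _ 0])
  then have m: "0 < m" by (simp add: m_def card_gt_0_iff)
  have "fourier_approx (hyp_cross g n) (B_class r p \<theta>) (Bq1_norm p)
      \<le> ennreal ((m * 6 ^ CARD('d) * m * C) * R n)" if n: "1 \<le> n" for n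
    unfolding fourier_approx_def
  proof (rule SUP_least)
    fix f assume f: "f \<in> B_class r p \<theta>"
    let ?Q = "hyp_cross g n"
    let ?h = "\<lambda>x. f x - fourier_sum ?Q f x"
    let ?T = "\<lambda>s. if real n \<le> weight s g then Lp_norm p (delta s f) else 0"
    have f0: "f \<in> Lp0 p" using f by (simp add: B_class_def)
    then have fL: "f \<in> Lp p" by (simp add: Lp0_def)
    have h0: "?h \<in> Lp0 p"
      unfolding fourier_sum_eq_trig_poly
      using f0 finite_hyp_cross[OF g1] hyp_cross_nonzero p by (rule Lp0_diff_trig_poly)
    have R0: "0 \<le> R n" by (simp add: R_def)
    have "(\<Sum>\<^sub>\<infinity>s\<in>block_indices. Lp_norm p (A_block s ?h)) \<le> ennreal ((m * 6 ^ CARD('d) * m * C) * R n)"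
    proof (rule infsum_le_finite_sums)
      fix F :: "(nat ^ 'd) set" assume F: "finite F" "F \<subseteq> block_indices"
      have "(\<Sum>s\<in>F. Lp_norm p (A_block s ?h))
          \<le> (\<Sum>s\<in>F. ennreal m * (ennreal (6 ^ CARD('d)) * (\<Sum>e\<in>?N. ?T (s + e))))"
        unfolding m_def using F by (intro sum_mono A_block_remainder_le p fL g1) auto
      also have "\<dots> = ennreal m * (ennreal (6 ^ CARD('d)) * (\<Sum>e\<in>?N. \<Sum>s\<in>F. ?T (s + e)))"
        by (subst sum.swap) (simp add: sum_distrib_left)
      also have "\<dots> \<le> ennreal m * (ennreal (6 ^ CARD('d)) * (\<Sum>e\<in>?N. ennreal (C * R n)))"
      proof (intro mult_left_mono sum_mono)
        fix e :: "nat ^ 'd"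
        \<comment> \<open>For a fixed shift, \<open>s + e\<close> determines \<open>s\<close>, so
          the sum runs over distinct blocks of the tail.\<close>
        have "(\<Sum>s\<in>F. ?T (s + e)) = (\<Sum>s\<in>(\<lambda>s. s + e) ` F. ?T s)"
          by (subst sum.reindex) (auto intro!: inj_onI)
        also have "\<dots> = (\<Sum>s | s \<in> (\<lambda>s. s + e) ` F \<and> real n \<le> weight s g. Lp_norm p (delta s f))"
          using F by (intro sum.inter_filter[symmetric]) simp
        also have "\<dots> \<le> ennreal (C * R n)"
          using F neighbours_add by (intro tail[rule_format] n f) auto
        finally show "(\<Sum>s\<in>F. ?T (s + e)) \<le> ennreal (C * R n)" .
      qed auto
      also have "\<dots> = ennreal m * (ennreal (6 ^ CARD('d)) * (ennreal m * ennreal (C * R n)))"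
        by (simp add: m_def ennreal_of_nat_eq_real_of_nat)
      also have "\<dots> = ennreal ((m * 6 ^ CARD('d) * m * C) * R n)"
        using m C R0 by (simp add: mult_ac flip: ennreal_mult)
      finally show "(\<Sum>s\<in>F. Lp_norm p (A_block s ?h)) \<le> ennreal ((m * 6 ^ CARD('d) * m * C) * R n)" .
    qed (simp add: nonneg_summable_on_complete)
    then show "Bq1_norm p ?h \<le> ennreal ((m * 6 ^ CARD('d) * m * C) * R n)"
      using h0 by (simp add: Bq1_norm_def)
  qed
  moreover have "0 < m * 6 ^ CARD('d) * m * C" using m C by simp
  ultimately show ?thesis unfolding R_def by blast
qed

section \<open>The lower bound\<close>

lemma best_approx_le_fourier_approx: "best_approx Q F nrm \<le> fourier_approx Q F nrm"
  unfolding best_approx_def fourier_approx_def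
proof (rule SUP_mono)
  fix f assume "f \<in> F"
  moreover have "fourier_sum Q f \<in> trig_polys Q"
    by (auto simp: trig_polys_def fourier_sum_def fun_eq_iff)
  ultimately show "\<exists>f'\<in>F. (INF t\<in>trig_polys Q. nrm (\<lambda>x. f x - t x)) \<le> nrm (\<lambda>x. f' x - fourier_sum Q f' x)"
    by (auto intro: INF_lower)
qed

text \<open>Opens the block \<open>s + 1\<close>, not \<open>s\<close>, although it is the kernel
  with index \<open>s\<close> that has coefficient 1 there. Hence membership in the class involves
  \<open>weight (s + 1) r\<close>, while annihilation involves \<open>weight s g\<close>.\<close>

definition power_freq :: "nat ^ 'd \<Rightarrow> int ^ 'd" where
  "power_freq s = (\<chi> j. 2 ^ (s $ j))"

lemma power_freq_rho: "power_freq s \<in> rho (s + 1)"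
  by (simp add: power_freq_def rho_def)

lemma A_coeff_power_freq:
  assumes "s \<in> block_indices" "m \<in> block_indices"
  shows "A_coeff s (power_freq m) = (if s = m then 1 else 0)"
proof -
  have "A_coeff s (power_freq m) = (\<Prod>j\<in>UNIV. if s $ j = m $ j then 1 else 0)"
    using assms by (auto simp: A_coeff_def power_freq_def block_indices_def a_coeff_power_of_two
        intro!: prod.cong)
  then show ?thesis
    by (auto simp: vec_eq_iff)
qed

lemma trig_poly_cong: "(\<And>k. k \<in> R \<Longrightarrow> c k = c' k) \<Longrightarrow> trig_poly R c = trig_poly R c'"
  by (simp add: trig_poly_def fun_eq_iff)

lemma trig_poly_single:
  assumes "finite R" "k0 \<in> R"
  shows "trig_poly R (\<lambda>k. if k = k0 then a else 0) = (\<lambda>x. a * char_exp k0 x)"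
  using assms by (auto simp: trig_poly_def fun_eq_iff if_distrib[of "\<lambda>c. c * _"] cong: if_cong)

text \<open>
  The frequency \<open>(2 ^ s\<^sub>j)\<^sub>j\<close> is seen by the block operator \<open>A_block s\<close> only, which in turn
  annihilates the trigonometric polynomials over the hyperbolic cross as soon as \<open>weight s g \<ge> n\<close>.
\<close>

lemma Bq1_norm_ge_lacunary:
  fixes g :: "real ^ 'd" and S :: "(nat ^ 'd) set" and n :: nat and a :: real
  assumes p: "1 \<le> p" and a: "0 \<le> a" and g: "\<And>j. 1 \<le> g $ j" and S: "finite S" "S \<subseteq> block_indices"
    and w: "\<And>s. s \<in> S \<Longrightarrow> real n \<le> weight s g"
    and t: "t \<in> trig_polys (hyp_cross g n)"
  shows "ennreal (real (card S) * a)
    \<le> Bq1_norm p (\<lambda>x. trig_poly (power_freq ` S) (\<lambda>_. of_real a) x - t x)"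
proof -
  let ?Q = "hyp_cross g n" and ?K = "power_freq ` S"
  have Q: "finite ?Q" by (rule finite_hyp_cross[OF g])
  obtain c where tc: "t = trig_poly ?Q c"
    using t by (auto simp: trig_polys_def trig_poly_def fun_eq_iff)
  define h where "h = (\<lambda>x. trig_poly ?K (\<lambda>_. of_real a) x - t x)"
  have i1: "integrable torus (trig_poly R c)" if "finite R" for R :: "(int ^ 'd) set" and c
    using that p by (intro Lp_integrable[OF p] trig_poly_Lp)
  have ih: "integrable torus h"
    unfolding h_def tc using S Q by (intro Bochner_Integration.integrable_diff i1) auto
  have ch: "fourier_coeff h k = (if k \<in> ?K then of_real a else 0) - (if k \<in> ?Q then c k else 0)" for k
    unfolding h_def tc using S Q by (simp add: fourier_coeff_diff i1 fourier_coeff_trig_poly)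
  have block: "Lp_norm p (A_block s h) = ennreal a" if s: "s \<in> S" for s
  proof -
    have sb: "s \<in> block_indices" using s S by auto
    have "fourier_coeff h k * of_real (A_coeff s k) = (if k = power_freq s then of_real a else 0)" for k
    proof (cases "A_coeff s k = 0")
      case True
      then have "k \<noteq> power_freq s" using A_coeff_power_freq[OF sb sb] by auto
      then show ?thesis using True by simp
    next
      case False
      from A_coeff_nonzeroD[OF sb this] obtain e where e: "e \<in> neighbours" "k \<in> rho (s + e)" by auto
      \<comment> \<open>The support of \<open>A_coeff s\<close> reaches only towards larger blocks,
        which therefore stay outside the cross.\<close>
      have "0 \<le> weight e g"
        unfolding weight_def using g by (intro sum_nonneg mult_nonneg_nonneg) (auto intro: order_trans[of 0 1])
      then have "\<not> weight (s + e) g < real n"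
        using w[OF s] by (simp add: weight_add)
      then have kQ: "k \<notin> ?Q"
        using rho_hyp_cross_iff[OF neighbours_add[OF sb] e(2)] by simp
      have "k \<in> ?K \<longleftrightarrow> k = power_freq s" and "k = power_freq s \<longrightarrow> A_coeff s k = 1"
        using False s S A_coeff_power_freq[OF sb] by (auto split: if_splits)
      then show ?thesis using kQ by (auto simp: ch)
    qed
    moreover have "power_freq s \<in> (\<Union>e\<in>neighbours. rho (s + e))"
      by (rule UN_I[of 1]) (simp_all add: neighbours_def power_freq_rho)
    ultimately have "A_block s h = (\<lambda>x. of_real a * char_exp (power_freq s) x)"
      unfolding A_block_eq[OF sb ih] by (simp add: trig_poly_single)
    then show ?thesis
      using p a by (simp add: Lp_norm_cmult_char_exp)
  qed
  have "ennreal (real (card S) * a) = (\<Sum>s\<in>S. Lp_norm p (A_block s h))"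
    using a by (simp add: block ennreal_mult ennreal_of_nat_eq_real_of_nat)
  also have "\<dots> \<le> (\<Sum>\<^sub>\<infinity>s\<in>block_indices. Lp_norm p (A_block s h))"
    using S by (intro sum_le_infsum_ennreal)
  \<comment> \<open>Membership of \<open>h\<close> in \<open>Lp0 p\<close> need not be checked:
    otherwise the right-hand side is infinite.\<close>
  also have "\<dots> \<le> Bq1_norm p h" by (simp add: Bq1_norm_def)
  finally show ?thesis by (simp add: h_def)
qed

text \<open>Each block \<open>s + 1\<close> with \<open>s\<close> in \<open>S\<close> holds a single
  frequency. The value of \<open>a\<close> makes its weighted norm
  \<open>card S powr - (1 / \<theta>)\<close>, so that the \<open>\<theta>\<close>-th powers add up
  to 1; for \<open>\<theta> = \<infinity>\<close> the weighted norms are themselves 1.\<close>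

lemma lacunary_in_B_class:
  fixes r :: "real ^ 'd" and S :: "(nat ^ 'd) set" and w p :: real and \<theta> :: ennreal
  assumes p: "1 \<le> p" and \<theta>: "1 \<le> \<theta>" and S: "finite S" "S \<noteq> {}" "S \<subseteq> block_indices"
    and w: "\<And>s. s \<in> S \<Longrightarrow> weight (s + 1) r = w"
  defines "a \<equiv> 2 powr - w * real (card S) powr - enn2real (1 / \<theta>)"
  shows "trig_poly (power_freq ` S) (\<lambda>_. of_real a) \<in> B_class r p \<theta>"
proof -
  let ?f = "trig_poly (power_freq ` S) (\<lambda>_. of_real a)"
  have a0: "0 \<le> a" by (simp add: a_def)
  have N: "0 < real (card S)" using S by (simp add: card_gt_0_iff)
  let ?S1 = "(\<lambda>s. s + 1) ` S"
  have cS1: "card ?S1 = card S" by (intro card_image) (simp add: inj_on_def)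
  have cf: "fourier_coeff ?f k = (if k \<in> power_freq ` S then of_real a else 0)" for k
    using S by (simp add: fourier_coeff_trig_poly)
  have norm: "Lp_norm p (delta s' ?f) = ennreal (if s' \<in> ?S1 then a else 0)" for s'
  proof (cases "s' \<in> ?S1")
    case True
    then obtain s where s: "s \<in> S" "s' = s + 1" by auto
    have "delta s' ?f = trig_poly (rho s') (\<lambda>k. if k = power_freq s then of_real a else 0)"
      unfolding delta_def fourier_sum_eq_trig_poly
    proof (rule trig_poly_cong)
      fix k assume k: "k \<in> rho s'"
      have "k \<in> power_freq ` S \<longleftrightarrow> k = power_freq s"
      proof
        assume "k \<in> power_freq ` S"
        then obtain m where m: "k = power_freq m" by auto
        then have "m + 1 = s + 1"
          using k power_freq_rho[of m] rho_disjoint s by metis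
        then show "k = power_freq s" using m by simp
      qed (use s in auto)
      then show "fourier_coeff ?f k = (if k = power_freq s then of_real a else 0)"
        by (simp add: cf)
    qed
    then show ?thesis
      using True p a0 s power_freq_rho[of s] by (simp add: trig_poly_single Lp_norm_cmult_char_exp)
  next
    case False
    have "delta s' ?f = trig_poly (rho s') (\<lambda>_. 0)"
      unfolding delta_def fourier_sum_eq_trig_poly
    proof (rule trig_poly_cong)
      fix k assume k: "k \<in> rho s'"
      have "k \<notin> power_freq ` S"
        using k False rho_disjoint power_freq_rho by blast
      then show "fourier_coeff ?f k = 0" by (simp add: cf)
    qed
    then show ?thesis using False p Lp_norm_const[of p 0 "delta s' ?f"] by (simp add: trig_poly_def)
  qed
  have le: "2 powr weight s' r * (if s' \<in> ?S1 then a else 0) \<le> real (card S) powr - enn2real (1 / \<theta>)" for s'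
    using w by (auto simp: a_def powr_minus simp flip: mult.assoc)
  have "B_norm r p \<theta> ?f \<le> 1"
  proof (cases \<theta>)
    case top
    have "ennreal (2 powr weight s' r) * Lp_norm p (delta s' ?f) \<le> 1" for s'
      using le[of s'] a0 N top unfolding norm by (simp add: ennreal_le_1 flip: ennreal_mult)
    then show ?thesis using top by (simp add: B_norm_def SUP_le_iff)
  next
    case (real t)
    with \<theta> have t: "1 \<le> t" by (metis ennreal_1 ennreal_le_iff)
    let ?h = "\<lambda>s'. ennreal (2 powr (weight s' r * t)) * epowr (Lp_norm p (delta s' ?f)) t"
    have h: "?h s' \<le> ennreal (if s' \<in> ?S1 then 1 / real (card S) else 0)" for s'
    proof (cases "s' \<in> ?S1")
      case True
      have "?h s' = ennreal ((2 powr weight s' r * a) powr t)"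
        unfolding norm using True a0 by (simp add: epowr_ennreal powr_mult powr_powr flip: ennreal_mult)
      also have "\<dots> \<le> ennreal ((real (card S) powr - enn2real (1 / \<theta>)) powr t)"
        using le[of s'] True a0 t by (intro ennreal_leI powr_mono2) auto
      also have "(real (card S) powr - enn2real (1 / \<theta>)) powr t = 1 / real (card S)"
        using t N real by (simp add: powr_powr one_div_ennreal powr_neg_one)
      finally show ?thesis using True by simp
    qed (use t in \<open>simp add: norm epowr_def\<close>)
    have "infsum ?h block_indices \<le> 1"
    proof (rule infsum_le_finite_sums)
      fix F :: "(nat ^ 'd) set" assume F: "finite F"
      have "sum ?h F \<le> (\<Sum>s'\<in>F. ennreal (if s' \<in> ?S1 then 1 / real (card S) else 0))"
        by (intro sum_mono h)
      also have "\<dots> = ennreal (\<Sum>s'\<in>F. if s' \<in> ?S1 then 1 / real (card S) else 0)"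
        by (rule sum_ennreal) auto
      also have "(\<Sum>s'\<in>F. if s' \<in> ?S1 then 1 / real (card S) else 0)
          = (\<Sum>s'\<in>F \<inter> ?S1. 1 / real (card S))"
        using F by (rule sum.inter_restrict[symmetric])
      also have "\<dots> \<le> (\<Sum>s'\<in>?S1. 1 / real (card S))"
        using S by (intro sum_mono2) auto
      also have "\<dots> = 1" using N by (simp only: sum_constant cS1) simp
      finally show "sum ?h F \<le> 1" by (simp add: ennreal_leI)
    qed (simp add: nonneg_summable_on_complete)
    then have "epowr (infsum ?h block_indices) (1 / t) \<le> epowr 1 (1 / t)"
      using t by (intro epowr_mono) auto
    also have "epowr 1 (1 / t) = 1" using epowr_ennreal[of 1 "1 / t"] by simp
    finally show ?thesis using t real by (simp add: B_norm_def)
  qed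
  moreover have "?f \<in> Lp0 p"
    using S p by (intro trig_poly_Lp0) (auto simp: power_freq_def)
  ultimately show ?thesis by (simp add: B_class_def)
qed

text \<open>The coordinates in \<open>V - {i0}\<close> vary freely up to a multiple of
  \<open>n\<close>, the coordinate \<open>i0\<close> completes the sum over \<open>V\<close> to
  \<open>n + card V\<close>, and the others are 1. The weight formula is stated for every vector
  constant on \<open>V\<close> because it is needed both for the cross and for the smoothness
  vector.\<close>

lemma lacunary_indices:
  fixes V :: "'d :: finite set" and n :: nat
  assumes i0: "i0 \<in> V"
  obtains S :: "(nat ^ 'd) set" where
    "finite S" "S \<subseteq> block_indices" "card S = (n div card V + 1) ^ (card V - 1)"
    "\<forall>s\<in>S. \<forall>g b. (\<forall>j\<in>V. g $ j = b) \<longrightarrow>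
       weight s g = b * (real n + real (card V)) + (\<Sum>j\<in>- V. g $ j)"
proof -
  \<comment> \<open>Large enough for order \<open>n ^ (card V - 1)\<close> choices; small enough
    that \<open>card V - 1\<close> such coordinates sum to less than \<open>n + card V\<close>,
    leaving at least 1 for \<open>i0\<close>.\<close>
  define m where "m = n div card V + 1"
  have cV: "0 < card V" using i0 by (auto simp: card_gt_0_iff)
  define A where "A j = (if j \<in> V - {i0} then {1..m} else {1})" for j :: 'd
  define U where "U = {u :: nat ^ 'd. \<forall>j. u $ j \<in> A j}"
  have A: "finite (A j)" for j by (simp add: A_def)
  have U: "finite U" unfolding U_def using A by (rule finite_vec_set)
  have "card U = (\<Sum>k\<in>U. \<Prod>j\<in>(UNIV :: 'd set). 1)" by simp
  also have "\<dots> = (\<Prod>j\<in>UNIV. \<Sum>y\<in>A j. 1)"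
    unfolding U_def using A by (rule prod_sum_vec[symmetric])
  also have "\<dots> = (\<Prod>j\<in>UNIV. if j \<in> V - {i0} then m else 1)"
    by (intro prod.cong) (auto simp: A_def)
  also have "\<dots> = (\<Prod>j\<in>V - {i0}. m)"
    using prod.inter_restrict[of UNIV "\<lambda>_. m" "V - {i0}"] by simp
  also have "\<dots> = m ^ (card V - 1)"
    using i0 by simp
  finally have cU: "card U = m ^ (card V - 1)" .
  define z where "z u = n + card V - (\<Sum>j\<in>V - {i0}. u $ j)" for u :: "nat ^ 'd"
  have sum_lt: "(\<Sum>j\<in>V - {i0}. u $ j) < n + card V" if "u \<in> U" for u
  proof -
    have "u $ j \<le> m" if "j \<in> V - {i0}" for j
    proof -
      have "u $ j \<in> A j" using \<open>u \<in> U\<close> by (simp add: U_def)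
      then show ?thesis using that by (simp add: A_def)
    qed
    then have "(\<Sum>j\<in>V - {i0}. u $ j) \<le> (\<Sum>j\<in>V - {i0}. m)" by (intro sum_mono)
    also have "\<dots> = (card V - 1) * (n div card V) + (card V - 1)"
      using i0 by (simp add: m_def)
    also have "\<dots> \<le> card V * (n div card V) + (card V - 1)" by simp
    also have "\<dots> < n + card V" using cV times_div_less_eq_dividend[of "card V" n] by linarith
    finally show ?thesis .
  qed
  define ins where "ins u = (\<chi> j. if j = i0 then z u else u $ j)" for u :: "nat ^ 'd"
  have inj: "inj_on ins U"
  proof (rule inj_onI)
    fix u v assume u: "u \<in> U" and v: "v \<in> U" and eq: "ins u = ins v"
    have "u $ j = v $ j" for j
    proof (cases "j = i0")
      case True
      have "u $ j \<in> A j" "v $ j \<in> A j" using u v by (auto simp: U_def)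
      then show ?thesis using True by (simp add: A_def)
    next
      case False
      have "ins u $ j = ins v $ j" using eq by simp
      then show ?thesis using False by (simp add: ins_def)
    qed
    then show "u = v" by (simp add: vec_eq_iff)
  qed
  show thesis
  proof (rule that[of "ins ` U"])
    show "finite (ins ` U)" using U by simp
    show "card (ins ` U) = (n div card V + 1) ^ (card V - 1)"
      using card_image[OF inj] cU by (simp add: m_def)
    show "ins ` U \<subseteq> block_indices"
    proof (clarsimp simp: block_indices_def)
      fix u j assume u: "u \<in> U"
      have "u $ j \<in> A j" using u by (simp add: U_def)
      then have "1 \<le> u $ j" by (auto simp: A_def split: if_splits)
      then show "Suc 0 \<le> ins u $ j"
        using sum_lt[OF u] by (simp add: ins_def z_def Suc_le_eq)
    qed
    show "\<forall>s\<in>ins ` U. \<forall>g b. (\<forall>j\<in>V. g $ j = b) \<longrightarrow>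
       weight s g = b * (real n + real (card V)) + (\<Sum>j\<in>- V. g $ j)"
    proof (intro ballI allI impI)
      fix s and g :: "real ^ 'd" and b :: real
      assume s: "s \<in> ins ` U" and g: "\<forall>j\<in>V. g $ j = b"
      then obtain u where u: "u \<in> U" "s = ins u" by auto
      have zu: "real (z u) + (\<Sum>j\<in>V - {i0}. real (u $ j)) = real n + real (card V)"
        using sum_lt[OF u(1)] by (simp add: z_def of_nat_diff less_imp_le)
      have off: "u $ j = 1" if "j \<notin> V" for j
      proof -
        have "u $ j \<in> A j" using u by (simp add: U_def)
        then show ?thesis using that by (simp add: A_def)
      qed
      have "weight s g = (\<Sum>j\<in>V. real (s $ j) * g $ j) + (\<Sum>j\<in>- V. real (s $ j) * g $ j)"
        unfolding weight_def by (subst sum.union_disjoint[symmetric]) (auto simp: Compl_partition)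
      also have "(\<Sum>j\<in>- V. real (s $ j) * g $ j) = (\<Sum>j\<in>- V. g $ j)"
        using off i0 by (intro sum.cong) (auto simp: u ins_def)
      also have "(\<Sum>j\<in>V. real (s $ j) * g $ j) = b * (\<Sum>j\<in>V. real (s $ j))"
        using g by (simp add: sum_distrib_left mult.commute)
      also have "(\<Sum>j\<in>V. real (s $ j)) = real (s $ i0) + (\<Sum>j\<in>V - {i0}. real (s $ j))"
        using i0 by (intro sum.remove) auto
      also have "\<dots> = real (z u) + (\<Sum>j\<in>V - {i0}. real (u $ j))"
        by (simp add: u ins_def)
      finally show "weight s g = b * (real n + real (card V)) + (\<Sum>j\<in>- V. g $ j)"
        by (simp add: zu)
    qed
  qed
qed

text \<open>All blocks of the lacunary polynomial have the same weight \<open>n * r0 + D\<close>, so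
  \<open>card S * a\<close> equals \<open>2 powr - (n * r0 + D)\<close> times
  \<open>card S powr (1 - \<eta>)\<close>.\<close>

lemma best_approx_lower:
  fixes r g :: "real ^ 'd" and V :: "'d set" and r0 p :: real and \<theta> :: ennreal
  assumes p: "1 \<le> p" and \<theta>: "1 \<le> \<theta>" and i0: "i0 \<in> V"
    and V: "\<forall>j\<in>V. r $ j = r0 \<and> g $ j = 1" and off: "\<forall>j\<in>- V. 1 < g $ j"
  shows "\<exists>c>0. \<forall>n\<ge>1. ennreal (c * (2 powr (- real n * r0)
      * real n powr ((real (card V) - 1) * (1 - enn2real (1 / \<theta>)))))
    \<le> best_approx (hyp_cross g n) (B_class r p \<theta>) (Bq1_norm p)"
proof -
  define \<eta> where "\<eta> = enn2real (1 / \<theta>)"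
  have \<eta>: "0 \<le> \<eta>" "\<eta> \<le> 1"
  proof -
    have "1 / \<theta> \<le> 1"
    proof (cases \<theta>)
      case (real t)
      with \<theta> have "1 \<le> t" by (metis ennreal_1 ennreal_le_iff)
      then have "1 / \<theta> = ennreal (1 / t)" using real divide_ennreal[of 1 t] by simp
      then show ?thesis using \<open>1 \<le> t\<close> by (simp add: ennreal_le_1)
    qed simp
    then show "\<eta> \<le> 1" unfolding \<eta>_def using enn2real_leI[of 1 "1 / \<theta>"] by simp
  qed (simp add: \<eta>_def)
  define \<nu> where "\<nu> = real (card V)"
  have cV: "0 < card V" using i0 by (auto simp: card_gt_0_iff)
  then have \<nu>: "1 \<le> \<nu>" by (simp add: \<nu>_def)
  have g1: "1 \<le> g $ j" for j using V off by (cases "j \<in> V") (auto intro: less_imp_le)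
  \<comment> \<open>The first two terms come from \<open>lacunary_indices\<close>; the last accounts
    for the passage from \<open>s\<close> to \<open>s + 1\<close>.\<close>
  define D where "D = r0 * \<nu> + (\<Sum>j\<in>- V. r $ j) + (\<Sum>j\<in>UNIV. r $ j)"
  \<comment> \<open>The power of \<nu> stems from the bound
    \<open>card S \<ge> (n / \<nu>) powr (\<nu> - 1)\<close>.\<close>
  define c where "c = 2 powr - D * \<nu> powr - ((\<nu> - 1) * (1 - \<eta>))"
  show ?thesis
  proof (intro exI[of _ c] conjI allI impI)
    show "0 < c" using \<nu> by (simp add: c_def)
    fix n :: nat assume n: "1 \<le> n"
    obtain S :: "(nat ^ 'd) set" where S: "finite S" "S \<subseteq> block_indices"
      and cS: "card S = (n div card V + 1) ^ (card V - 1)"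
      and wS: "\<forall>s\<in>S. \<forall>g b. (\<forall>j\<in>V. g $ j = b) \<longrightarrow>
         weight s g = b * (real n + real (card V)) + (\<Sum>j\<in>- V. g $ j)"
      by (rule lacunary_indices[OF i0, of n]) (rule that)
    have wg: "real n \<le> weight s g" if "s \<in> S" for s
    proof -
      have "0 \<le> (\<Sum>j\<in>- V. g $ j)" using g1 by (intro sum_nonneg) (auto intro: order_trans[of 0 1])
      then show ?thesis using wS[rule_format, OF that, of g 1] V by simp
    qed
    have wr: "weight (s + 1) r = real n * r0 + D" if "s \<in> S" for s
      using wS[rule_format, OF that, of r r0] V by (simp add: weight_add weight_def[of 1] D_def \<nu>_def algebra_simps)
    have NS: "0 < card S" by (simp add: cS)
    define a where "a = 2 powr - (real n * r0 + D) * real (card S) powr - \<eta>"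
    let ?f = "trig_poly (power_freq ` S) (\<lambda>_. of_real a)"
    have f: "?f \<in> B_class r p \<theta>"
      unfolding a_def \<eta>_def using S NS wr by (intro lacunary_in_B_class p \<theta>) auto
    have "(real n / \<nu>) powr (\<nu> - 1) \<le> real (card S)"
    proof -
      have "n < card V * (n div card V + 1)"
        using cV dividend_less_times_div[of "card V" n] by (simp add: add.commute)
      then have "real n < \<nu> * real (n div card V + 1)"
        unfolding \<nu>_def by (metis of_nat_less_iff of_nat_mult)
      then have "real n / \<nu> \<le> real (n div card V + 1)" using \<nu> by (simp add: field_simps)
      then have "(real n / \<nu>) ^ (card V - 1) \<le> real (n div card V + 1) ^ (card V - 1)"
        using \<nu> by (intro power_mono) auto
      moreover have "(real n / \<nu>) powr (\<nu> - 1) = (real n / \<nu>) ^ (card V - 1)"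
        using n \<nu> cV powr_realpow[of "real n / \<nu>" "card V - 1"] by (simp add: \<nu>_def of_nat_diff)
      ultimately show ?thesis by (simp add: cS)
    qed
    then have "((real n / \<nu>) powr (\<nu> - 1)) powr (1 - \<eta>) \<le> real (card S) powr (1 - \<eta>)"
      using \<eta> by (intro powr_mono2) auto
    then have "real n powr ((\<nu> - 1) * (1 - \<eta>)) * \<nu> powr - ((\<nu> - 1) * (1 - \<eta>)) \<le> real (card S) powr (1 - \<eta>)"
      using \<nu> by (simp add: powr_powr powr_divide powr_minus_divide)
    also have "\<dots> = real (card S) * real (card S) powr - \<eta>"
      using NS by (simp add: powr_diff powr_minus_divide)
    finally have "2 powr - (real n * r0 + D) *
        (real n powr ((\<nu> - 1) * (1 - \<eta>)) * \<nu> powr - ((\<nu> - 1) * (1 - \<eta>)))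
        \<le> 2 powr - (real n * r0 + D) * (real (card S) * real (card S) powr - \<eta>)"
      by (rule mult_left_mono) simp
    moreover have "2 powr - (real n * r0 + D) = 2 powr (- real n * r0) * 2 powr - D"
      by (simp flip: powr_add)
    ultimately have "c * (2 powr (- real n * r0) * real n powr ((\<nu> - 1) * (1 - \<eta>))) \<le> real (card S) * a"
      by (simp add: c_def a_def mult_ac)
    then have "ennreal (c * (2 powr (- real n * r0) * real n powr ((\<nu> - 1) * (1 - \<eta>))))
        \<le> ennreal (real (card S) * a)"
      by (rule ennreal_leI)
    also have "\<dots> \<le> (INF t\<in>trig_polys (hyp_cross g n). Bq1_norm p (\<lambda>x. ?f x - t x))"
      using S wg by (intro INF_greatest Bq1_norm_ge_lacunary p) (auto simp: a_def g1)
    also have "\<dots> \<le> best_approx (hyp_cross g n) (B_class r p \<theta>) (Bq1_norm p)"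
      unfolding best_approx_def by (rule SUP_upper[OF f])
    finally show "ennreal (c * (2 powr (- real n * r0)
        * real n powr ((real (card V) - 1) * (1 - enn2real (1 / \<theta>)))))
      \<le> best_approx (hyp_cross g n) (B_class r p \<theta>) (Bq1_norm p)"
      by (simp add: \<nu>_def \<eta>_def)
  qed
qed

text \<open>Closes the chain \<open>c * \<rho> \<le> e \<le> f \<le> C * \<rho>\<close>. Constants
  are moved across by multiplying with real reciprocals, which is safe for infinite values
  too.\<close>

lemma same_order_sandwich:
  assumes C: "0 < C" "0 < c" and ef: "\<And>n. 1 \<le> n \<Longrightarrow> e n \<le> f n"
    and up: "\<And>n. 1 \<le> n \<Longrightarrow> f n \<le> ennreal C * \<rho> n"
    and lo: "\<And>n. 1 \<le> n \<Longrightarrow> ennreal c * \<rho> n \<le> e n"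
  shows "f \<asymp> e \<and> e \<asymp> \<rho>"
proof -
  have inv: "ennreal (1 / x) * y \<le> z" if "0 < x" "y \<le> ennreal x * z" for x and y z :: ennreal
  proof -
    have "ennreal (1 / x) * y \<le> ennreal (1 / x) * (ennreal x * z)"
      using that by (intro mult_left_mono) auto
    also have "\<dots> = z" using that by (simp flip: mult.assoc ennreal_mult)
    finally show ?thesis .
  qed
  have inv': "y \<le> ennreal (1 / x) * z" if "0 < x" "ennreal x * y \<le> z" for x and y z :: ennreal
  proof -
    have "y = ennreal (1 / x) * (ennreal x * y)" using that by (simp flip: mult.assoc ennreal_mult)
    also have "\<dots> \<le> ennreal (1 / x) * z" using that by (intro mult_left_mono) auto
    finally show ?thesis .
  qed
  have "f \<asymp> e"
    unfolding same_order_def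
  proof (rule exI[of _ "c / C"], rule exI[of _ 1], intro conjI allI impI)
    fix n :: nat assume n: "1 \<le> n"
    have "ennreal (c / C) * f n = ennreal c * (ennreal (1 / C) * f n)"
      using C by (simp flip: mult.assoc ennreal_mult)
    also have "\<dots> \<le> ennreal c * \<rho> n"
      using C up[OF n] by (intro mult_left_mono inv) auto
    also have "\<dots> \<le> e n" by (rule lo[OF n])
    finally show "ennreal (c / C) * f n \<le> e n" .
    show "e n \<le> ennreal 1 * f n" using ef[OF n] by simp
  qed (use C in auto)
  moreover have "e \<asymp> \<rho>"
    unfolding same_order_def
  proof (rule exI[of _ "1 / C"], rule exI[of _ "1 / c"], intro conjI allI impI)
    fix n :: nat assume n: "1 \<le> n"
    show "ennreal (1 / C) * e n \<le> \<rho> n"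
      using C ef[OF n] up[OF n] by (intro inv) auto
    show "\<rho> n \<le> ennreal (1 / c) * e n"
      using C lo[OF n] by (intro inv')
  qed (use C in auto)
  ultimately show ?thesis ..
qed

theorem theorem3p2:
  fixes r \<gamma> \<gamma>' :: "real ^ 'd" and p :: real and \<theta> :: ennreal and \<nu> :: nat
    and ix :: "nat \<Rightarrow> 'd"
  assumes "CARD('d) \<ge> 2"
    and "bij_betw ix {1..CARD('d)} UNIV"
    and "1 < p"
    and "1 \<le> \<theta>"
    and "1 \<le> \<nu>" and "\<nu> \<le> CARD('d)"
    and "0 < r $ ix 1"
    and "\<forall>j\<in>{1..\<nu>}. r $ ix j = r $ ix 1"
    and "\<nu> < CARD('d) \<longrightarrow> r $ ix \<nu> < r $ ix (\<nu> + 1)"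
    and "\<forall>j\<in>{\<nu> + 1..<CARD('d)}. r $ ix j \<le> r $ ix (j + 1)"
    and "\<gamma> = (\<chi> i. r $ i / r $ ix 1)"
    and "\<forall>j\<in>{1..\<nu>}. \<gamma>' $ ix j = \<gamma> $ ix j \<and> \<gamma> $ ix j = 1"
    and "\<forall>j\<in>{\<nu> + 1..CARD('d)}. 1 < \<gamma>' $ ix j \<and> \<gamma>' $ ix j < \<gamma> $ ix j"
  shows "(\<lambda>n. fourier_approx (hyp_cross \<gamma>' n) (B_class r p \<theta>) (Bq1_norm p))
           \<asymp> (\<lambda>n. best_approx (hyp_cross \<gamma>' n) (B_class r p \<theta>) (Bq1_norm p))
       \<and> (\<lambda>n. best_approx (hyp_cross \<gamma>' n) (B_class r p \<theta>) (Bq1_norm p))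
           \<asymp> (\<lambda>n. ennreal (2 powr (- real n * r $ ix 1)
                  * real n powr ((real \<nu> - 1) * (1 - enn2real (1 / \<theta>)))))"
proof -
  \<comment> \<open>The coordinates of minimal smoothness; the estimates are phrased with this set
    instead of the enumeration \<open>ix\<close>.\<close>
  define V where "V = ix ` {1..\<nu>}"
  have inj: "inj_on ix {1..CARD('d)}" and surj: "ix ` {1..CARD('d)} = UNIV"
    using assms(2) by (auto simp: bij_betw_def)
  have "inj_on ix {1..\<nu>}"
    using inj assms(6) by (rule_tac inj_on_subset) auto
  then have cV: "card V = \<nu>" by (simp add: V_def card_image)
  have i0: "ix 1 \<in> V" using assms(5) by (simp add: V_def)
  have V: "\<forall>j\<in>V. r $ j = r $ ix 1 \<and> \<gamma>' $ j = 1"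
  proof
    fix j assume "j \<in> V"
    then obtain l where l: "l \<in> {1..\<nu>}" "j = ix l" by (auto simp: V_def)
    show "r $ j = r $ ix 1 \<and> \<gamma>' $ j = 1"
      using bspec[OF assms(8) l(1)] bspec[OF assms(12) l(1)] unfolding l(2) by (metis (no_types))
  qed
  have off: "\<forall>j\<in>- V. 1 < \<gamma>' $ j \<and> r $ ix 1 * \<gamma>' $ j < r $ j"
  proof
    fix j assume j: "j \<in> - V"
    obtain l where l: "l \<in> {1..CARD('d)}" "j = ix l" using surj by (metis UNIV_I imageE)
    then have "l \<in> {\<nu> + 1..CARD('d)}" using j by (auto simp: V_def not_le Suc_le_eq)
    from bspec[OF assms(13) this] have "1 < \<gamma>' $ j" "\<gamma>' $ j < r $ j / r $ ix 1"
      unfolding l(2) assms(11) by simp_all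
    then show "1 < \<gamma>' $ j \<and> r $ ix 1 * \<gamma>' $ j < r $ j"
      using assms(7) by (simp add: field_simps)
  qed
  then have off1: "\<forall>j\<in>- V. 1 < \<gamma>' $ j" by blast
  have p: "1 \<le> p" using assms(3) by simp
  define R where "R n = 2 powr (- real n * r $ ix 1) * real n powr ((real \<nu> - 1) * (1 - enn2real (1 / \<theta>)))"
    for n
  obtain C where C: "0 < C" "\<forall>n\<ge>1. fourier_approx (hyp_cross \<gamma>' n) (B_class r p \<theta>) (Bq1_norm p)
      \<le> ennreal (C * R n)"
    using fourier_approx_upper[OF p assms(4) i0 assms(7) V off, unfolded cV, folded R_def]
    by (elim exE conjE) (rule that)
  obtain c where c: "0 < c" "\<forall>n\<ge>1. ennreal (c * R n)
      \<le> best_approx (hyp_cross \<gamma>' n) (B_class r p \<theta>) (Bq1_norm p)"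
    using best_approx_lower[OF p assms(4) i0 V off1, unfolded cV, folded R_def]
    by (elim exE conjE) (rule that)
  have R0: "0 \<le> R n" for n by (simp add: R_def)
  show ?thesis
    unfolding R_def[symmetric]
  proof (rule same_order_sandwich[OF C(1) c(1)])
    fix n :: nat assume n: "1 \<le> n"
    show "fourier_approx (hyp_cross \<gamma>' n) (B_class r p \<theta>) (Bq1_norm p) \<le> ennreal C * ennreal (R n)"
      using C n R0[of n] by (simp flip: ennreal_mult)
    show "ennreal c * ennreal (R n) \<le> best_approx (hyp_cross \<gamma>' n) (B_class r p \<theta>) (Bq1_norm p)"
      using c n R0[of n] by (simp flip: ennreal_mult)
  qed (rule best_approx_le_fourier_approx)
qed

end
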